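(* Let $n\ge1$ and $k(1)\ge k(2)\ge\dots\ge k(n)\ge3$ be integers, $r=\sum_{i=1}^nk(i)$, and let $M$ be the abelian T-motive over $\mathbb F_q[T]$ with $\mathbb C_\infty[\tau]$-basis $e_1,\dots,e_n$ and $$Te_i=\theta e_i+\sum_{\alpha=1}^n\sum_{j=1}^{k(\alpha)-1}a_{j,i,\alpha}\tau^je_\alpha+\tau^{k(i)}e_i\qquad(i=1,\dots,n),$$ with arbitrary $a_{j,i,\alpha}\in\mathbb C_\infty$. Let $\nu$ be any bijection from the set of pairs $(i,j)$ with $1\le i\le n$, $1\le j\le k(i)-2$ onto $\{n+1,\dots,r-n\}$. Define $(r-n)\times(r-n)$ matrices $B_1=(b_{1,\gamma,\delta})$, $B_2=(b_{2,\gamma,\delta})$ by (for $i,\alpha\in\{1,\dots,n\}$): $b_{1,i,\alpha}=-a_{k(i)-1,\alpha,i}$; $b_{1,\nu(i,j),\alpha}=-a_{j,\alpha,i}$ for $1\le j\le k(i)-2$; $b_{1,\nu(i,j+1),\nu(i,j)}=1$ for $1\le j\le k(i)-3$; $b_{1,i,\nu(i,k(i)-2)}=1$; $b_{2,\nu(i,1),i}=1$; all other entries $0$. Let $B=\theta E_{r-n}+B_1\tau+B_2\tau^2$ and let $M(B)$ be the module with $\mathbb C_\infty[\tau]$-basis $e'_1,\dots,e'_{r-n}$ and $Te'_*=Be'_*$. Then $M(B)$ is the dual $M'$ of $M$.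
   Context: $\mathbb C_\infty$ is the completion of an algebraic closure of $\mathbb F_q((1/\theta))$; $\mathbb C_\infty[T,\tau]$ has relations $Ta=aT$, $T\tau=\tau T$, $\tau a=a^q\tau$. An abelian T-motive is a left $\mathbb C_\infty[T,\tau]$-module free and finitely generated over $\mathbb C_\infty[T]$ and over $\mathbb C_\infty[\tau]$ with $(T-\theta)^m(M/\tau M)=0$ for some $m$. The dual of $M$: if $f_*$ is a $\mathbb C_\infty[T]$-basis of $M$ with $\tau f_*=Qf_*$, an abelian T-motive $M'$ is the dual if it has a $\mathbb C_\infty[T]$-basis $f'_*$ with $\tau f'_*=(T-\theta)(Q^t)^{-1}f'_*$ (equivalently $M'=\mathrm{Hom}(M,\mathfrak C)$ rationally, with $\tau\varphi=\tau\circ\varphi\circ\tau^{-1}$, $\mathfrak C$ the Carlitz motive $\tau\mathfrak f=(T-\theta)\mathfrak f$). In the notation above, $a_{j,i,\alpha}$ is the $(i,\alpha)$ entry of the matrix $A_j$ in $Te_*=\sum_jA_j\tau^je_*$. *)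

theory Defs
  imports
    "HOL-Library.Cardinality"
    "HOL-Computational_Algebra.Formal_Laurent_Series"
    "HOL-Computational_Algebra.Polynomial_Factorial"
    "Jordan_Normal_Form.Matrix"
begin

definition algebraic_closure_in :: "'c::field set \<Rightarrow> 'c set \<Rightarrow> bool" where
  "algebraic_closure_in k K \<longleftrightarrow>
     k \<subseteq> K \<and>
     (\<forall>x\<in>K. \<forall>y\<in>K. x - y \<in> K \<and> x * y \<in> K \<and> inverse x \<in> K) \<and>
     (\<forall>x\<in>K. \<exists>p. p \<noteq> 0 \<and> (\<forall>i. coeff p i \<in> k) \<and> poly p x = 0) \<and>
     (\<forall>p. (\<forall>i. coeff p i \<in> K) \<and> degree p > 0 \<longrightarrow> (\<exists>x\<in>K. poly p x = 0))"

text \<open>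
  The finite field \<open>F\<^sub>q\<close> is a type \<open>'f\<close> with \<open>q = CARD('f)\<close>; the field \<open>F\<^sub>q((1/\<theta>))\<close> is
  \<open>'f fls\<close>, whose variable \<open>fls_X\<close> stands for \<open>1/\<theta>\<close>. The completion of an algebraic closure
  of \<open>F\<^sub>q((1/\<theta>))\<close> is determined only up to isomorphism, hence it is described by an embedding
  \<open>\<iota>\<close> into a field \<open>'c\<close> with a metric. The absolute value of \<open>x\<close> is \<open>dist x 0\<close>, normalized by
  \<open>\<bar>\<theta>\<bar> = q\<close>.
\<close>

definition is_C_infinity :: "('f::{field,finite} fls \<Rightarrow> 'c::{field,metric_space}) \<Rightarrow> bool" where
  "is_C_infinity \<iota> \<longleftrightarrow>
     \<iota> 1 = 1 \<and> (\<forall>f g. \<iota> (f + g) = \<iota> f + \<iota> g) \<and> (\<forall>f g. \<iota> (f * g) = \<iota> f * \<iota> g) \<and>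
     (\<forall>x y :: 'c. dist x y = dist (x - y) 0) \<and>
     (\<forall>x y :: 'c. dist (x * y) 0 = dist x 0 * dist y 0) \<and>
     (\<forall>x y :: 'c. dist (x + y) 0 \<le> max (dist x 0) (dist y 0)) \<and>
     (\<forall>f. f \<noteq> 0 \<longrightarrow> dist (\<iota> f) 0 = real CARD('f) powi (- fls_subdegree f)) \<and>
     complete (UNIV :: 'c set) \<and>
     (\<exists>K. algebraic_closure_in (range \<iota>) K \<and> (\<forall>x. \<forall>\<epsilon>>0. \<exists>y\<in>K. dist x y < \<epsilon>))"

definition C_infinity_theta :: "('f::{field,finite} fls \<Rightarrow> 'c::{field,metric_space}) \<Rightarrow> 'c" where
  "C_infinity_theta \<iota> = \<iota> fls_X_inv"

text \<open>
  A left module over \<open>C[T,\<tau>]\<close>, the ring generated over \<open>C\<close> by \<open>T\<close>, \<open>\<tau>\<close> with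
  \<open>T a = a T\<close>, \<open>T \<tau> = \<tau> T\<close>, \<open>\<tau> a = a\<^sup>q \<tau>\<close>, is a \<open>C\<close>-vector space together with additive
  operators \<open>T\<close> and \<open>\<tau>\<close> satisfying these relations.
\<close>

locale T_tau_module = vector_space scale
  for scale :: "'c::field \<Rightarrow> 'm::ab_group_add \<Rightarrow> 'm" +
  fixes q :: nat and T \<tau> :: "'m \<Rightarrow> 'm"
  assumes T_add: "T (x + y) = T x + T y"
    and tau_add: "\<tau> (x + y) = \<tau> x + \<tau> y"
    and T_scale: "T (scale a x) = scale a (T x)"
    and T_tau: "T (\<tau> x) = \<tau> (T x)"
    and tau_scale: "\<tau> (scale a x) = scale (a ^ q) (\<tau> x)"

text \<open>
  The action of \<open>\<Sum>\<^sub>i c\<^sub>i \<phi>\<^sup>i\<close> on \<open>x\<close>, coefficients on the left. With \<open>\<phi> = T\<close> this is the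
  \<open>C[T]\<close>-module structure. With \<open>\<phi> = \<tau>\<close> it is the \<open>C[\<tau>]\<close>-module structure: a skew polynomial
  is given by its coefficients as an element of \<open>'c poly\<close>, whose commutative multiplication
  plays no role then.
\<close>

definition poly_act :: "('c::field \<Rightarrow> 'm::ab_group_add \<Rightarrow> 'm) \<Rightarrow> ('m \<Rightarrow> 'm) \<Rightarrow> 'c poly \<Rightarrow> 'm \<Rightarrow> 'm"
  where "poly_act scale \<phi> p x = (\<Sum>i\<le>degree p. scale (coeff p i) ((\<phi> ^^ i) x))"

definition is_basis ::
  "('c::field \<Rightarrow> 'm::ab_group_add \<Rightarrow> 'm) \<Rightarrow> ('m \<Rightarrow> 'm) \<Rightarrow> nat set \<Rightarrow> (nat \<Rightarrow> 'm) \<Rightarrow> bool" where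
  "is_basis scale \<phi> I f \<longleftrightarrow> finite I \<and>
     (\<forall>x. \<exists>c. x = (\<Sum>i\<in>I. poly_act scale \<phi> (c i) (f i))) \<and>
     (\<forall>c. (\<Sum>i\<in>I. poly_act scale \<phi> (c i) (f i)) = 0 \<longrightarrow> (\<forall>i\<in>I. c i = 0))"

text \<open>
  The last condition is \<open>(T - \<theta>)\<^sup>m (M / \<tau>M) = 0\<close>.
\<close>

definition abelian_T_motive ::
  "nat \<Rightarrow> 'c::field \<Rightarrow> ('c \<Rightarrow> 'm::ab_group_add \<Rightarrow> 'm) \<Rightarrow> ('m \<Rightarrow> 'm) \<Rightarrow> ('m \<Rightarrow> 'm) \<Rightarrow> bool" where
  "abelian_T_motive q \<theta> scale T \<tau> \<longleftrightarrow>
     T_tau_module scale q T \<tau> \<and>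
     (\<exists>r f. is_basis scale T {..<r} f) \<and>
     (\<exists>n e. is_basis scale \<tau> {..<n} e) \<and>
     (\<exists>m. \<forall>x. ((\<lambda>y. T y - scale \<theta> y) ^^ m) x \<in> range \<tau>)"

definition tau_matrix ::
  "('c::field \<Rightarrow> 'm::ab_group_add \<Rightarrow> 'm) \<Rightarrow> ('m \<Rightarrow> 'm) \<Rightarrow> ('m \<Rightarrow> 'm) \<Rightarrow>
   nat \<Rightarrow> (nat \<Rightarrow> 'm) \<Rightarrow> 'c poly mat \<Rightarrow> bool" where
  "tau_matrix scale T \<tau> r f Q \<longleftrightarrow>
     Q \<in> carrier_mat r r \<and>
     (\<forall>i<r. \<tau> (f i) = (\<Sum>j<r. poly_act scale T (Q $$ (i, j)) (f j)))"

text \<open>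
  The inverse \<open>P\<close> of the transpose of \<open>Q\<close> is formed over the fraction field \<open>C(T)\<close>. The condition
  does not depend on the choice of the basis \<open>f\<close> of \<open>M\<close>; it is required for every choice.
\<close>

definition is_dual_T_motive ::
  "nat \<Rightarrow> 'c::field \<Rightarrow>
   ('c \<Rightarrow> 'm::ab_group_add \<Rightarrow> 'm) \<Rightarrow> ('m \<Rightarrow> 'm) \<Rightarrow> ('m \<Rightarrow> 'm) \<Rightarrow>
   ('c \<Rightarrow> 'n::ab_group_add \<Rightarrow> 'n) \<Rightarrow> ('n \<Rightarrow> 'n) \<Rightarrow> ('n \<Rightarrow> 'n) \<Rightarrow> bool" where
  "is_dual_T_motive q \<theta> scale T \<tau> scale' T' \<tau>' \<longleftrightarrow>
     abelian_T_motive q \<theta> scale T \<tau> \<and>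
     abelian_T_motive q \<theta> scale' T' \<tau>' \<and>
     (\<forall>r f Q. is_basis scale T {..<r} f \<and> tau_matrix scale T \<tau> r f Q \<longrightarrow>
        (\<exists>f' R P. is_basis scale' T' {..<r} f' \<and> tau_matrix scale' T' \<tau>' r f' R \<and>
           P \<in> carrier_mat r r \<and>
           inverts_mat P (map_mat to_fract (transpose_mat Q)) \<and>
           inverts_mat (map_mat to_fract (transpose_mat Q)) P \<and>
           map_mat to_fract R = to_fract [:- \<theta>, 1:] \<cdot>\<^sub>m P))"

end

theory Submission
  imports Defs "HOL-Library.Function_Algebras" "Jordan_Normal_Form.Determinant"
begin

text \<open>
  Write \<open>D = {(i, j). 1 \<le> i \<le> n, 0 \<le> j < k(i)}\<close>. The motive \<open>M\<close> has the \<open>T\<close>-basis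
  \<open>f(i,j) = \<tau>\<^sup>j e\<^sub>i\<close>, and \<open>M(B)\<close> has the \<open>T\<close>-basis \<open>f'(i,0) = \<tau> e'\<^sub>i\<close>,
  \<open>f'(i,j) = e'\<close> at \<open>\<nu>(i,j)\<close> for \<open>0 < j < k(i) - 1\<close>, \<open>f'(i,k(i)-1) = e'\<^sub>i\<close>. In these bases the
  relations defining \<open>M\<close> and \<open>M(B)\<close> say that \<open>\<tau>\<close> acts by explicit matrices \<open>Q\<close> and \<open>R\<close> with
  \<open>R Q\<^sup>t = T - \<theta>\<close>. Such a family spans because its \<open>T\<close>-span is stable under \<open>\<tau>\<close> and contains the
  \<open>\<tau>\<close>-basis; it is independent because the \<open>\<tau>\<close>-basis can be mapped into the free \<open>T\<close>-module on \<open>D\<close>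
  with \<open>\<tau>\<close> given by the matrix, and this map turns the family into the unit vectors. An arbitrary
  basis \<open>f = U f\<^sub>0\<close> of \<open>M\<close> with \<open>f\<^sub>0 = V f\<close> is matched by the basis \<open>V\<^sup>t f'\<^sub>0\<close> of \<open>M(B)\<close>.
\<close>

section \<open>Polynomial actions\<close>

lemma poly_act_bound:
  assumes "vector_space scale" "degree p \<le> N"
  shows "poly_act scale \<phi> p x = (\<Sum>i\<le>N. scale (coeff p i) ((\<phi> ^^ i) x))"
proof -
  interpret vector_space scale by fact
  show ?thesis unfolding poly_act_def
    by (rule sum.mono_neutral_left) (use assms(2) in \<open>auto simp: coeff_eq_0\<close>)
qed

context vector_space
begin

lemma poly_act_0 [simp]: "poly_act scale \<phi> 0 x = 0"
  by (simp add: poly_act_def)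

lemma poly_act_add: "poly_act scale \<phi> (p + p') x = poly_act scale \<phi> p x + poly_act scale \<phi> p' x"
proof -
  let ?N = "max (degree p) (degree p')"
  note bd = poly_act_bound[OF vector_space_axioms, where N = ?N]
  show ?thesis
    by (simp add: bd degree_add_le_max scale_left_distrib sum.distrib)
qed

lemma poly_act_smult: "poly_act scale \<phi> (Polynomial.smult c p) x = scale c (poly_act scale \<phi> p x)"
proof -
  note bd = poly_act_bound[OF vector_space_axioms, where N = "degree p"]
  show ?thesis
    by (simp add: bd scale_sum_right)
qed

lemma poly_act_pCons: "poly_act scale \<phi> (pCons a p) x = scale a x + poly_act scale \<phi> p (\<phi> x)"
proof -
  have "poly_act scale \<phi> (pCons a p) x = (\<Sum>i\<le>Suc (degree p). scale (coeff (pCons a p) i) ((\<phi> ^^ i) x))"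
    by (rule poly_act_bound[OF vector_space_axioms]) (simp add: degree_pCons_le)
  then show ?thesis
    by (simp add: sum.atMost_Suc_shift funpow_swap1 poly_act_def del: sum.atMost_Suc)
qed

end

text \<open>The same condition as \<open>is_basis\<close>, but with an index set of any type: the
  natural bases here are indexed by pairs (i, j).\<close>

definition free_family ::
  "('c::field \<Rightarrow> 'm::ab_group_add \<Rightarrow> 'm) \<Rightarrow> ('m \<Rightarrow> 'm) \<Rightarrow> 'i set \<Rightarrow> ('i \<Rightarrow> 'm) \<Rightarrow> bool" where
  "free_family scale \<phi> I f \<longleftrightarrow> finite I \<and>
     (\<forall>x. \<exists>c. x = (\<Sum>i\<in>I. poly_act scale \<phi> (c i) (f i))) \<and>
     (\<forall>c. (\<Sum>i\<in>I. poly_act scale \<phi> (c i) (f i)) = 0 \<longrightarrow> (\<forall>i\<in>I. c i = 0))"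

lemma free_family_span:
  assumes "free_family scale \<phi> I f"
  obtains c where "x = (\<Sum>i\<in>I. poly_act scale \<phi> (c i) (f i))"
  using assms unfolding free_family_def by blast

lemma free_family_unique:
  assumes "free_family scale \<phi> I f" "(\<Sum>i\<in>I. poly_act scale \<phi> (c i) (f i)) = 0" "i \<in> I"
  shows "c i = 0"
  using assms unfolding free_family_def by blast

lemma is_basis_free_family: "is_basis scale \<phi> I f \<longleftrightarrow> free_family scale \<phi> I f"
  by (simp add: is_basis_def free_family_def)

lemma free_family_reindex:
  assumes f: "free_family scale \<phi> D f" and \<pi>: "bij_betw \<pi> I D"
  shows "free_family scale \<phi> I (\<lambda>i. f (\<pi> i))"
proof -
  have fin: "finite I"
    using f \<pi> bij_betw_finite by (auto simp: free_family_def)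
  have re: "(\<Sum>i\<in>I. poly_act scale \<phi> (c (\<pi> i)) (f (\<pi> i))) = (\<Sum>d\<in>D. poly_act scale \<phi> (c d) (f d))" for c
    by (rule sum.reindex_bij_betw[OF \<pi>])
  have inv: "the_inv_into I \<pi> (\<pi> i) = i" if "i \<in> I" for i
    using \<pi> that by (simp add: bij_betw_def the_inv_into_f_f)
  show ?thesis unfolding free_family_def
  proof (intro conjI allI impI fin)
    fix x
    obtain c where "x = (\<Sum>d\<in>D. poly_act scale \<phi> (c d) (f d))"
      by (rule free_family_span[OF f])
    then show "\<exists>c. x = (\<Sum>i\<in>I. poly_act scale \<phi> (c i) (f (\<pi> i)))"
      using re[of c] by (intro exI[of _ "\<lambda>i. c (\<pi> i)"]) simp
  next
    fix c assume *: "(\<Sum>i\<in>I. poly_act scale \<phi> (c i) (f (\<pi> i))) = 0"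
    let ?c = "\<lambda>d. c (the_inv_into I \<pi> d)"
    have "(\<Sum>d\<in>D. poly_act scale \<phi> (?c d) (f d)) = 0"
      unfolding re[symmetric] using * by (simp add: inv)
    then have "?c d = 0" if "d \<in> D" for d
      using that by (rule free_family_unique[OF f])
    then show "\<forall>i\<in>I. c i = 0"
      using bij_betwE[OF \<pi>] inv by fastforce
  qed
qed

section \<open>Frobenius twists of polynomials\<close>

text \<open>The change that a polynomial undergoes when \<tau> is moved past it.\<close>

definition twist :: "nat \<Rightarrow> 'c::field poly \<Rightarrow> 'c poly" where
  "twist q p = map_poly (\<lambda>a. a ^ q) p"

text \<open>Isolates what the arguments use of the Frobenius of \<open>'c\<close>. Positivity of
  \<open>q\<close> ensures that 0 is sent to 0, so that twisting respects zero coefficients.\<close>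

definition additive_power :: "nat \<Rightarrow> 'c::field itself \<Rightarrow> bool" where
  "additive_power q _ \<longleftrightarrow> q > 0 \<and> (\<forall>a b :: 'c. (a + b) ^ q = a ^ q + b ^ q)"

context
  fixes q :: nat and C :: "'c::field itself"
  assumes ap: "additive_power q C"
begin

lemma coeff_twist: "coeff (twist q p) i = coeff (p :: 'c poly) i ^ q"
  using ap by (simp add: twist_def additive_power_def coeff_map_poly)

lemma twist_0 [simp]: "twist q (0 :: 'c poly) = 0"
  by (simp add: twist_def)

lemma twist_1: "twist q (1 :: 'c poly) = 1"
  using ap by (simp add: poly_eq_iff coeff_twist additive_power_def coeff_1)

lemma twist_add: "twist q (p + p' :: 'c poly) = twist q p + twist q p'"
  using ap by (simp add: poly_eq_iff coeff_twist additive_power_def)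

lemma twist_smult: "twist q (Polynomial.smult a p :: 'c poly) = Polynomial.smult (a ^ q) (twist q p)"
  by (simp add: poly_eq_iff coeff_twist power_mult_distrib)

lemma twist_pCons: "twist q (pCons a p :: 'c poly) = pCons (a ^ q) (twist q p)"
  by (simp add: poly_eq_iff coeff_twist coeff_pCons split: nat.splits)

lemma twist_mult: "twist q (p * p' :: 'c poly) = twist q p * twist q p'"
  using ap by (induction p) (simp_all add: twist_add twist_smult twist_pCons additive_power_def)

end

section \<open>Modules over the ring generated by \<open>T\<close> and \<open>\<tau>\<close>\<close>

context T_tau_module
begin

lemma T_0 [simp]: "T 0 = 0"
  using T_add[of 0 0] by simp

lemma tau_0 [simp]: "\<tau> 0 = 0"
  using tau_add[of 0 0] by simp

lemma tau_sum: "\<tau> (\<Sum>i\<in>I. x i) = (\<Sum>i\<in>I. \<tau> (x i))"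
  by (induction I rule: infinite_finite_induct) (simp_all add: tau_add)

lemma T_poly_act: "T (poly_act scale T p x) = poly_act scale T p (T x)"
  by (induction p arbitrary: x) (simp_all add: poly_act_pCons T_add T_scale)

text \<open>Since \<open>T\<close> commutes with scalars, composing actions corresponds to the
  commutative product of polynomials, which opens the library of modules over a commutative ring.
  For \<tau> this would fail.\<close>

sublocale T_module: Modules.module "poly_act scale T"
proof
  fix p p' :: "'c poly" and x y
  show "poly_act scale T p (x + y) = poly_act scale T p x + poly_act scale T p y"
    by (induction p arbitrary: x y) (simp_all add: poly_act_pCons T_add scale_right_distrib)
  show "poly_act scale T (p + p') x = poly_act scale T p x + poly_act scale T p' x"
    by (rule poly_act_add)
  show "poly_act scale T p (poly_act scale T p' x) = poly_act scale T (p * p') x"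
    by (induction p arbitrary: x)
      (simp_all add: poly_act_pCons poly_act_add poly_act_smult T_poly_act)
  show "poly_act scale T 1 x = x"
    by (simp add: poly_act_def)
qed

lemma poly_act_T_const: "poly_act scale T [:c:] x = scale c x"
  by (simp add: poly_act_pCons)

text \<open>Every element is a finite sum of terms c \<tau>^j e(i), so it is reached from the
  generators by \<tau>, scalars and addition.\<close>

lemma tau_induct:
  assumes e: "free_family scale \<tau> I e"
    and "\<And>i. i \<in> I \<Longrightarrow> P (e i)" and "P 0"
    and "\<And>x y. P x \<Longrightarrow> P y \<Longrightarrow> P (x + y)" and "\<And>c x. P x \<Longrightarrow> P (scale c x)"
    and "\<And>x. P x \<Longrightarrow> P (\<tau> x)"
  shows "P x"
proof -
  obtain c where x: "x = (\<Sum>i\<in>I. poly_act scale \<tau> (c i) (e i))"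
    by (rule free_family_span[OF e])
  have pow: "P ((\<tau> ^^ j) (e i))" if "i \<in> I" for i j
    using that by (induction j) (auto intro: assms)
  have S: "P (sum g J)" if "\<And>j. j \<in> J \<Longrightarrow> P (g j)" for g :: "'z \<Rightarrow> 'm" and J
    using that by (induction J rule: infinite_finite_induct) (auto intro: assms)
  show ?thesis unfolding x poly_act_def
    by (intro S assms pow)
qed

text \<open>Moving \<tau> to the right past a coefficient raises that coefficient to the power
  \<open>q\<close>, and the extra \<tau> shifts the degrees by one.\<close>

lemma tau_poly_act_tau:
  assumes "additive_power q TYPE('c)"
  shows "\<tau> (poly_act scale \<tau> p x) = poly_act scale \<tau> (pCons 0 (twist q p)) x"
  by (induction p arbitrary: x)
    (simp_all add: poly_act_pCons twist_pCons[OF assms] tau_add tau_scale twist_0[OF assms])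

lemma tau_poly_act_T:
  assumes "additive_power q TYPE('c)"
  shows "\<tau> (poly_act scale T p x) = poly_act scale T (twist q p) (\<tau> x)"
  by (induction p arbitrary: x)
    (simp_all add: poly_act_pCons twist_pCons[OF assms] tau_add tau_scale twist_0[OF assms] T_tau)

text \<open>Expanding \<tau> of (a + b) e(i) in two ways compares two multiples of \<tau> e(i), and
  freeness makes \<tau> e(i) nonzero. Additivity of the Frobenius is thus read off the module,
  without computing the characteristic of \<open>'c\<close>.\<close>

lemma additive_power_if_free:
  assumes e: "free_family scale \<tau> I e" and i: "i \<in> I" and q: "q > 0"
  shows "additive_power q TYPE('c)"
proof -
  have ne: "\<tau> (e i) \<noteq> 0"
  proof
    assume "\<tau> (e i) = 0"
    then have "(\<Sum>j\<in>I. poly_act scale \<tau> (if j = i then [:0, 1:] else 0) (e j)) = 0"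
      by (intro sum.neutral) (auto simp: poly_act_pCons)
    from free_family_unique[OF e this i] show False by simp
  qed
  have "(a + b) ^ q = a ^ q + b ^ q" for a b :: 'c
  proof -
    have "scale ((a + b) ^ q) (\<tau> (e i)) = \<tau> (scale (a + b) (e i))"
      by (simp add: tau_scale)
    also have "\<dots> = scale (a ^ q + b ^ q) (\<tau> (e i))"
      by (simp add: scale_left_distrib tau_add tau_scale)
    finally show ?thesis using ne by simp
  qed
  with q show ?thesis by (simp add: additive_power_def)
qed

text \<open>Stability under scalars is where \<open>q\<close>-th roots enter: c \<tau>(y) = \<tau>(b
  y) as soon as b^q = c.\<close>

lemma subspace_range_tau:
  assumes perfect: "\<And>c :: 'c. \<exists>b. b ^ q = c"
  shows "subspace (range \<tau>)"
proof (rule subspaceI)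
  show "0 \<in> range \<tau>" by (rule range_eqI[of _ _ 0]) simp
  show "x + y \<in> range \<tau>" if "x \<in> range \<tau>" "y \<in> range \<tau>" for x y
    using that by (auto simp flip: tau_add)
  show "scale c x \<in> range \<tau>" if x: "x \<in> range \<tau>" for c x
  proof -
    obtain b y where "b ^ q = c" "x = \<tau> y" using perfect[of c] x by blast
    then have "scale c x = \<tau> (scale b y)" by (simp add: tau_scale)
    then show ?thesis by simp
  qed
qed

text \<open>T - \<theta> is linear over the scalars, and on \<tau> x both T \<tau> x = \<tau> T x
  and \<theta> \<tau> x lie in the range, so the generators decide.\<close>

lemma T_minus_theta_in_range_tau:
  assumes e: "free_family scale \<tau> I e"
    and sub: "subspace (range \<tau>)"
    and gen: "\<And>i. i \<in> I \<Longrightarrow> T (e i) - scale \<theta> (e i) \<in> range \<tau>"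
  shows "T x - scale \<theta> x \<in> range \<tau>"
proof (induction x rule: tau_induct[OF e])
  case (3 x y)
  have "T (x + y) - scale \<theta> (x + y) = (T x - scale \<theta> x) + (T y - scale \<theta> y)"
    by (simp add: T_add scale_right_distrib)
  then show ?case using subspace_add[OF sub 3] by simp
next
  case (4 c x)
  have "T (scale c x) - scale \<theta> (scale c x) = scale c (T x - scale \<theta> x)"
    by (simp add: T_scale scale_right_diff_distrib mult.commute)
  then show ?case using subspace_scale[OF sub 4] by simp
next
  case (5 x)
  have "T (\<tau> x) - scale \<theta> (\<tau> x) = \<tau> (T x) - scale \<theta> (\<tau> x)"
    by (simp add: T_tau)
  then show ?case using subspace_diff[OF sub rangeI subspace_scale[OF sub rangeI]] by metis
qed (use gen subspace_0[OF sub] in auto)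

definition T_span :: "'i set \<Rightarrow> ('i \<Rightarrow> 'm) \<Rightarrow> 'm set" where
  "T_span D f = range (\<lambda>c. \<Sum>s\<in>D. poly_act scale T (c s) (f s))"

lemma T_span_0: "0 \<in> T_span D f"
  unfolding T_span_def by (rule range_eqI[of _ _ "\<lambda>_. 0"]) simp

lemma T_span_add: "x \<in> T_span D f \<Longrightarrow> y \<in> T_span D f \<Longrightarrow> x + y \<in> T_span D f"
  unfolding T_span_def
proof clarify
  fix c d
  show "(\<Sum>s\<in>D. poly_act scale T (c s) (f s)) + (\<Sum>s\<in>D. poly_act scale T (d s) (f s))
    \<in> range (\<lambda>c. \<Sum>s\<in>D. poly_act scale T (c s) (f s))"
    by (rule range_eqI[of _ _ "\<lambda>s. c s + d s"]) (simp add: poly_act_add sum.distrib)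
qed

lemma T_span_poly_act: "x \<in> T_span D f \<Longrightarrow> poly_act scale T p x \<in> T_span D f"
  unfolding T_span_def
proof clarify
  fix c
  show "poly_act scale T p (\<Sum>s\<in>D. poly_act scale T (c s) (f s))
    \<in> range (\<lambda>c. \<Sum>s\<in>D. poly_act scale T (c s) (f s))"
    by (rule range_eqI[of _ _ "\<lambda>s. p * c s"]) (simp add: T_module.scale_sum_right)
qed

lemma T_span_sum: "(\<And>j. j \<in> J \<Longrightarrow> g j \<in> T_span D f) \<Longrightarrow> sum g J \<in> T_span D f"
  by (induction J rule: infinite_finite_induct) (auto intro: T_span_0 T_span_add)

lemma T_span_base: "finite D \<Longrightarrow> s \<in> D \<Longrightarrow> f s \<in> T_span D f"
proof -
  assume "finite D" "s \<in> D"
  then have "(\<Sum>t\<in>D. poly_act scale T (if t = s then 1 else 0) (f t)) = f s"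
    by (simp add: if_distrib[of "\<lambda>p. poly_act scale T p _"] cong: if_cong)
  then show ?thesis unfolding T_span_def
    by (intro range_eqI[of _ _ "\<lambda>t. if t = s then 1 else 0"]) simp
qed

text \<open>Because \<tau>(p f) = \<open>twist q p\<close> \<tau>(f), a \<open>T\<close>-span that
  contains \<tau> of its generators is stable under \<tau>; then induction from the \<tau>-basis
  reaches everything.\<close>

lemma T_span_eq_UNIV:
  assumes ap: "additive_power q TYPE('c)" and e: "free_family scale \<tau> I e"
    and e_span: "\<And>i. i \<in> I \<Longrightarrow> e i \<in> T_span D f"
    and tau_span: "\<And>s. s \<in> D \<Longrightarrow> \<tau> (f s) \<in> T_span D f"
  shows "x \<in> T_span D f"
proof (induction x rule: tau_induct[OF e])
  case (4 c x)
  then show ?case using T_span_poly_act[of x D f "[:c:]"] by (simp add: poly_act_T_const)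
next
  case (5 x)
  then obtain c where "x = (\<Sum>s\<in>D. poly_act scale T (c s) (f s))"
    by (auto simp: T_span_def)
  then show ?case
    by (auto simp: tau_sum tau_poly_act_T[OF ap] intro!: T_span_sum T_span_poly_act tau_span)
qed (use e_span in \<open>auto intro: T_span_0 T_span_add\<close>)

end

section \<open>Semilinear maps out of free \<open>\<tau>\<close>-modules\<close>

lemma additive_sum:
  fixes \<Phi> :: "'a::ab_group_add \<Rightarrow> 'b::ab_group_add"
  assumes "\<forall>x y. \<Phi> (x + y) = \<Phi> x + \<Phi> y"
  shows "\<Phi> (\<Sum>i\<in>I. g i) = (\<Sum>i\<in>I. \<Phi> (g i))"
proof -
  have "\<Phi> (0 + 0) = \<Phi> 0 + \<Phi> 0" using assms by blast
  then have "\<Phi> 0 = 0" by simp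
  then show ?thesis
    by (induction I rule: infinite_finite_induct) (simp_all add: assms)
qed

locale T_tau_pair = M: T_tau_module scale q T \<tau> + N: T_tau_module scale' q T' \<tau>'
  for scale :: "'c::field \<Rightarrow> 'm::ab_group_add \<Rightarrow> 'm" and q T \<tau>
    and scale' :: "'c \<Rightarrow> 'n::ab_group_add \<Rightarrow> 'n" and T' \<tau>'
begin

definition T_tau_hom :: "('m \<Rightarrow> 'n) \<Rightarrow> bool" where
  "T_tau_hom \<Phi> \<longleftrightarrow> (\<forall>x y. \<Phi> (x + y) = \<Phi> x + \<Phi> y) \<and> (\<forall>c x. \<Phi> (scale c x) = scale' c (\<Phi> x)) \<and>
     (\<forall>x. \<Phi> (T x) = T' (\<Phi> x)) \<and> (\<forall>x. \<Phi> (\<tau> x) = \<tau>' (\<Phi> x))"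

text \<open>Freeness over \<tau> extends any choice of images semilinearly, and compatibility with
  \<open>T\<close> needs checking only on the generators, since \<open>T\<close> commutes with
  scalars and \<tau>. The hypothesis \<open>rel\<close> ranges over all candidate maps, so that
  \<Phi> (T (e i)) can be expanded before \<Phi> has been constructed.\<close>

lemma ex_T_tau_hom:
  assumes ap: "additive_power q TYPE('c)" and e: "free_family scale \<tau> I e"
    and rel: "\<And>\<Phi> i. i \<in> I \<Longrightarrow> \<forall>j\<in>I. \<Phi> (e j) = g j \<Longrightarrow>
      \<forall>x y. \<Phi> (x + y) = \<Phi> x + \<Phi> y \<Longrightarrow> \<forall>c x. \<Phi> (scale c x) = scale' c (\<Phi> x) \<Longrightarrow>
      \<forall>x. \<Phi> (\<tau> x) = \<tau>' (\<Phi> x) \<Longrightarrow> \<Phi> (T (e i)) = T' (g i)"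
  obtains \<Phi> where "T_tau_hom \<Phi>" "\<And>i. i \<in> I \<Longrightarrow> \<Phi> (e i) = g i"
proof -
  let ?s = "\<lambda>c. \<Sum>i\<in>I. poly_act scale \<tau> (c i) (e i)"
  let ?s' = "\<lambda>c. \<Sum>i\<in>I. poly_act scale' \<tau>' (c i) (g i)"
  have "\<forall>x. \<exists>c. x = ?s c"
    using e by (simp add: free_family_def)
  then obtain co where co: "\<And>x. ?s (co x) = x"
    by metis
  define \<Phi> where "\<Phi> x = ?s' (co x)" for x
  \<comment> \<open>By freeness the chosen coefficients of \<open>?s c\<close> agree with
    \<open>c\<close> on \<open>I\<close>. So \<Phi> may be computed from any representation, and its
    properties become identities between coefficients.\<close>
  have \<Phi>_s: "\<Phi> (?s c) = ?s' c" for c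
  proof -
    let ?d = "\<lambda>i. co (?s c) i + Polynomial.smult (-1) (c i)"
    have "?s ?d = ?s (co (?s c)) - ?s c"
      by (simp only: M.poly_act_add M.poly_act_smult sum.distrib M.scale_sum_right[symmetric]) simp
    then have "?s ?d = 0"
      by (simp add: co)
    then have "?d i = 0" if "i \<in> I" for i
      by (rule free_family_unique[OF e _ that])
    then have "co (?s c) i = c i" if "i \<in> I" for i
      using that by force
    then show ?thesis by (simp add: \<Phi>_def)
  qed
  have fin: "finite I"
    using e by (simp add: free_family_def)
  have add: "\<Phi> (x + y) = \<Phi> x + \<Phi> y" for x y
    using \<Phi>_s[of "\<lambda>i. co x i + co y i"]
    by (simp add: M.poly_act_add N.poly_act_add sum.distrib co \<Phi>_def[symmetric])
  have scl: "\<Phi> (scale c x) = scale' c (\<Phi> x)" for c x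
    using \<Phi>_s[of "\<lambda>i. Polynomial.smult c (co x i)"]
    by (simp add: M.poly_act_smult N.poly_act_smult M.scale_sum_right[symmetric]
        N.scale_sum_right[symmetric] co \<Phi>_def[symmetric])
  have tau: "\<Phi> (\<tau> x) = \<tau>' (\<Phi> x)" for x
    using \<Phi>_s[of "\<lambda>i. pCons 0 (twist q (co x i))"]
    by (simp only: M.tau_poly_act_tau[OF ap, symmetric] N.tau_poly_act_tau[OF ap, symmetric]
        M.tau_sum[symmetric] N.tau_sum[symmetric] co \<Phi>_def[symmetric])
  have \<Phi>_e: "\<Phi> (e i) = g i" if "i \<in> I" for i
  proof -
    have "?s (\<lambda>j. if j = i then [:1:] else 0) = e i"
      using that fin by (simp add: if_distrib[of "\<lambda>p. poly_act _ _ p _"] M.poly_act_pCons cong: if_cong)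
    moreover have "?s' (\<lambda>j. if j = i then [:1:] else 0) = g i"
      using that fin by (simp add: if_distrib[of "\<lambda>p. poly_act _ _ p _"] N.poly_act_pCons cong: if_cong)
    ultimately show ?thesis using \<Phi>_s by metis
  qed
  have T0: "\<Phi> 0 = 0" using add[of 0 0] by simp
  have "\<Phi> (T x) = T' (\<Phi> x)" for x
  proof (induction x rule: M.tau_induct[OF e])
    case (1 i)
    then show ?case using rel[of i \<Phi>] \<Phi>_e add scl tau by simp
  qed (simp_all add: add scl tau T0 M.T_add N.T_add M.T_scale N.T_scale M.T_tau N.T_tau)
  then have "T_tau_hom \<Phi>"
    using add scl tau by (simp add: T_tau_hom_def)
  then show ?thesis using \<Phi>_e that by blast
qed

lemma T_tau_hom_poly_act:
  assumes "T_tau_hom \<Phi>"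
  shows "\<Phi> (poly_act scale T p x) = poly_act scale' T' p (\<Phi> x)"
proof (induction p arbitrary: x)
  case 0
  have "\<Phi> (0 + 0) = \<Phi> 0 + \<Phi> 0" using assms unfolding T_tau_hom_def by blast
  then show ?case by simp
qed (use assms in \<open>simp_all add: M.poly_act_pCons N.poly_act_pCons T_tau_hom_def\<close>)

lemma T_tau_hom_sum:
  assumes "T_tau_hom \<Phi>"
  shows "\<Phi> (\<Sum>i\<in>I. x i) = (\<Sum>i\<in>I. \<Phi> (x i))"
  using assms by (intro additive_sum) (simp add: T_tau_hom_def)

end

section \<open>The free \<open>T\<close>-module with prescribed \<open>\<tau>\<close>-matrix\<close>

definition vec_scale :: "'c::field \<Rightarrow> ('i \<Rightarrow> 'c poly) \<Rightarrow> ('i \<Rightarrow> 'c poly)" where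
  "vec_scale c u = (\<lambda>s. Polynomial.smult c (u s))"

definition vec_T :: "('i \<Rightarrow> 'c::field poly) \<Rightarrow> ('i \<Rightarrow> 'c poly)" where
  "vec_T u = (\<lambda>s. pCons 0 (u s))"

text \<open>Row \<open>s\<close> of \<open>R\<close> holds the coordinates of \<tau> of the unit
  vector at \<open>s\<close>, so a row vector is twisted and then multiplied by \<open>R\<close> on
  the right. Vectors live on the whole index type; coordinates outside \<open>D\<close> are ignored
  and set to 0.\<close>

definition vec_tau :: "nat \<Rightarrow> 'i set \<Rightarrow> ('i \<Rightarrow> 'i \<Rightarrow> 'c::field poly) \<Rightarrow> ('i \<Rightarrow> 'c poly) \<Rightarrow> ('i \<Rightarrow> 'c poly)" where
  "vec_tau q D R u = (\<lambda>t. if t \<in> D then \<Sum>s\<in>D. twist q (u s) * R s t else 0)"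

definition vec_unit :: "'i \<Rightarrow> ('i \<Rightarrow> 'c::field poly)" where
  "vec_unit s = (\<lambda>t. if t = s then 1 else 0)"

text \<open>Any matrix \<open>R\<close> is admissible: twisting changes coefficients but fixes the
  variable, so \<tau> commutes with the coordinatewise shift \<open>vec_T\<close>.\<close>

lemma T_tau_module_vec:
  assumes ap: "additive_power q TYPE('c::field)"
  shows "T_tau_module (vec_scale :: 'c \<Rightarrow> ('i \<Rightarrow> 'c poly) \<Rightarrow> _) q vec_T (vec_tau q D R)"
proof
  fix a b :: 'c and x y :: "'i \<Rightarrow> 'c poly"
  show "vec_scale a (x + y) = vec_scale a x + vec_scale a y"
    by (simp add: vec_scale_def fun_eq_iff smult_add_right)
  show "vec_scale (a + b) x = vec_scale a x + vec_scale b x"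
    by (simp add: vec_scale_def fun_eq_iff smult_add_left)
  show "vec_scale a (vec_scale b x) = vec_scale (a * b) x"
    by (simp add: vec_scale_def)
  show "vec_scale 1 x = x"
    by (simp add: vec_scale_def)
  show "vec_T (x + y) = vec_T x + vec_T y"
    by (simp add: vec_T_def fun_eq_iff)
  show "vec_tau q D R (x + y) = vec_tau q D R x + vec_tau q D R y"
    by (simp add: vec_tau_def fun_eq_iff twist_add[OF ap] distrib_right sum.distrib)
  show "vec_T (vec_scale a x) = vec_scale a (vec_T x)"
    by (simp add: vec_scale_def vec_T_def)
  have "pCons 0 (\<Sum>s\<in>D. g s) = (\<Sum>s\<in>D. pCons 0 (g s))" for g :: "'i \<Rightarrow> 'c poly"
    by (simp add: poly_eq_iff coeff_sum coeff_pCons split: nat.splits)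
  then show "vec_T (vec_tau q D R x) = vec_tau q D R (vec_T x)"
    using ap[unfolded additive_power_def]
    by (auto simp: zero_power vec_T_def vec_tau_def twist_pCons[OF ap] fun_eq_iff)
  show "vec_tau q D R (vec_scale a x) = vec_scale (a ^ q) (vec_tau q D R x)"
    by (simp add: vec_scale_def vec_tau_def twist_smult[OF ap] fun_eq_iff poly_eq_iff coeff_sum
        sum_distrib_left)
qed

lemma poly_act_vec:
  assumes ap: "additive_power q TYPE('c::field)"
  shows "poly_act vec_scale vec_T p u = (\<lambda>t. p * (u t :: 'c poly))"
proof -
  interpret T_tau_module "vec_scale :: 'c \<Rightarrow> ('a \<Rightarrow> 'c poly) \<Rightarrow> _" q vec_T "vec_tau q D R" for D R
    by (rule T_tau_module_vec[OF ap])
  show ?thesis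
    by (induction p arbitrary: u) (simp_all add: poly_act_pCons fun_eq_iff vec_scale_def vec_T_def)
qed

lemma sum_fun_apply: "(\<Sum>i\<in>I. g i) t = (\<Sum>i\<in>I. g i t :: 'c::comm_monoid_add)"
  by (induction I rule: infinite_finite_induct) simp_all

lemma vec_tau_unit:
  assumes ap: "additive_power q TYPE('c::field)" and D: "finite D" "s \<in> D"
  shows "vec_tau q D R (vec_unit s :: _ \<Rightarrow> 'c poly) = (\<Sum>t\<in>D. poly_act vec_scale vec_T (R s t) (vec_unit t))"
proof
  fix t
  have "(\<Sum>s'\<in>D. twist q (vec_unit s s' :: 'c poly) * R s' t) = (\<Sum>s'\<in>D. if s' = s then R s t else 0)"
    unfolding vec_unit_def by (intro sum.cong) (auto simp: twist_1[OF ap] twist_0[OF ap])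
  moreover have "(\<Sum>t'\<in>D. R s t' * vec_unit t' t) = (\<Sum>t'\<in>D. if t' = t then R s t else 0)"
    unfolding vec_unit_def by (intro sum.cong) auto
  ultimately show "vec_tau q D R (vec_unit s :: _ \<Rightarrow> 'c poly) t
      = (\<Sum>t\<in>D. poly_act vec_scale vec_T (R s t) (vec_unit t)) t"
    using D by (simp add: vec_tau_def sum_fun_apply poly_act_vec[OF ap])
qed

text \<open>Since the \<open>\<tau>\<close>-module is free, its generators can be sent to the vectors that play the same
  role in the model; the images of the \<open>f s\<close> are the unit vectors, so no \<open>T\<close>-relation can hold.\<close>

lemma free_family_if_model:
  fixes scale :: "'c::field \<Rightarrow> 'm::ab_group_add \<Rightarrow> 'm" and R :: "'i \<Rightarrow> 'i \<Rightarrow> 'c poly"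
  assumes M: "T_tau_module scale q T \<tau>" and ap: "additive_power q TYPE('c)"
    and e: "free_family scale \<tau> I e" and D: "finite D"
    and e_f: "\<And>i. i \<in> I \<Longrightarrow> \<sigma> i \<in> D \<and> e i = f (\<sigma> i)"
    and tau_f: "\<And>s. s \<in> D \<Longrightarrow> \<tau> (f s) = (\<Sum>t\<in>D. poly_act scale T (R s t) (f t))"
    and rel: "\<And>\<Phi> i. i \<in> I \<Longrightarrow> \<forall>j\<in>I. \<Phi> (e j) = vec_unit (\<sigma> j) \<Longrightarrow>
      \<forall>x y. \<Phi> (x + y) = \<Phi> x + \<Phi> y \<Longrightarrow> \<forall>c x. \<Phi> (scale c x) = vec_scale c (\<Phi> x) \<Longrightarrow>
      \<forall>x. \<Phi> (\<tau> x) = vec_tau q D R (\<Phi> x) \<Longrightarrow> \<Phi> (T (e i)) = vec_T (vec_unit (\<sigma> i))"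
    and f_gen: "\<And>\<Phi> s. s \<in> D \<Longrightarrow> \<forall>i\<in>I. \<Phi> (e i) = vec_unit (\<sigma> i) \<Longrightarrow>
      \<forall>x. \<Phi> (\<tau> x) = vec_tau q D R (\<Phi> x) \<Longrightarrow> \<Phi> (f s) = vec_unit s"
  shows "free_family scale T D f"
proof -
  interpret T_tau_pair scale q T \<tau> "vec_scale :: 'c \<Rightarrow> ('i \<Rightarrow> 'c poly) \<Rightarrow> _" vec_T "vec_tau q D R"
    using M T_tau_module_vec[OF ap] by (rule T_tau_pair.intro)
  obtain \<Phi> where \<Phi>: "T_tau_hom \<Phi>" "\<And>i. i \<in> I \<Longrightarrow> \<Phi> (e i) = vec_unit (\<sigma> i)"
    by (rule ex_T_tau_hom[OF ap e, of "\<lambda>i. vec_unit (\<sigma> i)"]) (use rel in blast)+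
  have \<Phi>_f: "\<Phi> (f s) = vec_unit s" if "s \<in> D" for s
    using f_gen[OF that, of \<Phi>] \<Phi> by (simp add: T_tau_hom_def)
  have span: "x \<in> M.T_span D f" for x
  proof (rule M.T_span_eq_UNIV[OF ap e])
    show "e i \<in> M.T_span D f" if "i \<in> I" for i
      using e_f[OF that] M.T_span_base[OF D] by metis
    show "\<tau> (f s) \<in> M.T_span D f" if "s \<in> D" for s
      using tau_f[OF that] by (auto simp: M.T_span_def)
  qed
  show ?thesis unfolding free_family_def
  proof (intro conjI allI impI D)
    show "\<exists>c. x = (\<Sum>i\<in>D. poly_act scale T (c i) (f i))" for x
      using span[of x] by (auto simp: M.T_span_def)
  next
    fix c assume "(\<Sum>i\<in>D. poly_act scale T (c i) (f i)) = 0"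
    moreover have "\<Phi> 0 = 0" using T_tau_hom_sum[OF \<Phi>(1), of "\<lambda>_. 0" "{}"] by simp
    ultimately have "(\<Sum>i\<in>D. \<Phi> (poly_act scale T (c i) (f i))) = 0"
      by (metis T_tau_hom_sum[OF \<Phi>(1)])
    then have sum0: "(\<Sum>i\<in>D. (\<lambda>t. c i * vec_unit i t)) = (0 :: 'i \<Rightarrow> 'c poly)"
      by (simp add: T_tau_hom_poly_act[OF \<Phi>(1)] \<Phi>_f poly_act_vec[OF ap])
    have "c t = 0" if "t \<in> D" for t
    proof -
      have "(\<Sum>i\<in>D. if i = t then c t else 0) = (\<Sum>i\<in>D. c i * vec_unit i t)"
        by (intro sum.cong) (auto simp: vec_unit_def)
      also have "\<dots> = 0"
        using fun_cong[OF sum0, of t] by (simp add: sum_fun_apply)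
      finally show ?thesis using that D by simp
    qed
    then show "\<forall>i\<in>D. c i = 0" by blast
  qed
qed

section \<open>Frobenius is onto\<close>

text \<open>Roots taken in the dense algebraically closed subfield form a Cauchy sequence, because an
  additive \<open>q\<close>-th power satisfies \<open>\<bar>x - y\<bar>\<^sup>q = \<bar>x\<^sup>q - y\<^sup>q\<bar>\<close>.\<close>

lemma is_C_infinity_perfect:
  fixes \<iota> :: "'f::{field,finite} fls \<Rightarrow> 'c::{field,metric_space}"
  assumes C: "is_C_infinity \<iota>" and ap: "additive_power q TYPE('c)"
  shows "\<exists>b. b ^ q = (c :: 'c)"
proof -
  have dist_diff: "dist x y = dist (x - y) 0" for x y :: 'c
    using C unfolding is_C_infinity_def by blast
  have dist_mult: "dist (x * y) 0 = dist x 0 * dist y 0" for x y :: 'c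
    using C unfolding is_C_infinity_def by blast
  have complete: "complete (UNIV :: 'c set)"
    using C unfolding is_C_infinity_def by blast
  have q: "q > 0" and pow_add: "(x + y) ^ q = x ^ q + y ^ q" for x y :: 'c
    using ap by (auto simp: additive_power_def)
  have pow_diff: "(x - y) ^ q = x ^ q - y ^ q" for x y :: 'c
    using pow_add[of "x - y" y] by simp
  have "dist (1 :: 'c) 0 * dist (1 :: 'c) 0 = dist (1 :: 'c) 0 * 1"
    using dist_mult[of 1 1] by simp
  then have dist1: "dist (1 :: 'c) 0 = 1"
    by (metis mult_cancel_left dist_eq_0_iff zero_neq_one)
  have dist_pow: "dist (x ^ m) 0 = dist x 0 ^ m" for x :: 'c and m
    by (induction m) (simp_all add: dist1 dist_mult)
  have dist_q: "dist (x ^ q) (y ^ q) = dist x y ^ q" for x y :: 'c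
    using dist_diff[of "x ^ q"] dist_diff[of x] by (simp add: pow_diff[symmetric] dist_pow)
  obtain K where K: "algebraic_closure_in (range \<iota>) K" and dense: "\<And>x \<epsilon>. \<epsilon> > 0 \<Longrightarrow> \<exists>y\<in>K. dist x y < \<epsilon>"
    using C unfolding is_C_infinity_def by blast
  \<comment> \<open>A zero of X^q - y in the algebraically closed \<open>K\<close>. The constants 0,
    1 and -y belong to \<open>K\<close> because it contains the image of 1 and is closed under
    subtraction.\<close>
  have root: "\<exists>z\<in>K. z ^ q = y" if y: "y \<in> K" for y
  proof -
    have one: "1 \<in> K"
      using K C unfolding algebraic_closure_in_def is_C_infinity_def by (metis rangeI subsetD)
    have diff: "\<And>x y. x \<in> K \<Longrightarrow> y \<in> K \<Longrightarrow> x - y \<in> K"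
      using K unfolding algebraic_closure_in_def by blast
    have zero: "0 \<in> K" using diff[OF one one] by simp
    have neg: "- y \<in> K" using diff[OF zero y] by simp
    let ?p = "monom 1 q + [:- y:]"
    have cf: "coeff ?p i \<in> K" for i
      using one zero neg diff[OF one y] q by (auto simp: coeff_pCons split: nat.splits)
    have "degree ?p = q"
      using q by (subst degree_add_eq_left) (simp_all add: degree_monom_eq)
    then have "\<exists>z\<in>K. poly ?p z = 0"
      using K q cf unfolding algebraic_closure_in_def by metis
    then show ?thesis by (auto simp: poly_monom)
  qed
  have "\<exists>z. dist c (z ^ q) < inverse (real (Suc m))" for m
    using dense[of "inverse (real (Suc m))" c] root by (metis inverse_positive_iff_positive of_nat_0_less_iff zero_less_Suc)
  then obtain z where z: "\<And>m. dist c (z m ^ q) < inverse (real (Suc m))"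
    by metis
  have lim: "(\<lambda>m. z m ^ q) \<longlonglongrightarrow> c"
  proof (rule metric_LIMSEQ_I)
    fix \<epsilon> :: real assume "\<epsilon> > 0"
    then obtain N where N: "inverse (real (Suc N)) < \<epsilon>"
      using reals_Archimedean by blast
    have "dist (z m ^ q) c < \<epsilon>" if "m \<ge> N" for m
    proof -
      have "inverse (real (Suc m)) \<le> inverse (real (Suc N))"
        using that by (intro le_imp_inverse_le) auto
      with z[of m] N show ?thesis unfolding dist_commute[of _ c] by linarith
    qed
    then show "\<exists>N. \<forall>m\<ge>N. dist (z m ^ q) c < \<epsilon>" by blast
  qed
  have "Cauchy z"
  proof (rule metric_CauchyI)
    fix \<epsilon> :: real assume \<epsilon>: "\<epsilon> > 0"
    obtain N where N: "\<And>m m'. m \<ge> N \<Longrightarrow> m' \<ge> N \<Longrightarrow> dist (z m ^ q) (z m' ^ q) < \<epsilon> ^ q"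
      using LIMSEQ_imp_Cauchy[OF lim] \<epsilon> unfolding Cauchy_def by (meson zero_less_power)
    then show "\<exists>N. \<forall>m\<ge>N. \<forall>m'\<ge>N. dist (z m) (z m') < \<epsilon>"
      unfolding dist_q using \<epsilon> by (meson less_imp_le power_less_imp_less_base)
  qed
  then obtain b where b: "z \<longlonglongrightarrow> b"
    using complete unfolding complete_def by blast
  \<comment> \<open>Continuity of the \<open>q\<close>-th power at \<open>b\<close> is read off the
    identity \<open>dist_q\<close>, so b^q is the limit of the same sequence as
    \<open>c\<close>.\<close>
  have "(\<lambda>m. dist (z m) b ^ q) \<longlonglongrightarrow> 0 ^ q"
    by (intro tendsto_power) (rule tendsto_dist_iff[THEN iffD1, OF b])
  then have "(\<lambda>m. z m ^ q) \<longlonglongrightarrow> b ^ q"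
    unfolding tendsto_dist_iff[of _ "b ^ q"] dist_q using q by (simp add: zero_power)
  then show ?thesis using lim LIMSEQ_unique by blast
qed

section \<open>Change of basis\<close>

context T_tau_module
begin

text \<open>Treats a family as a column of module elements, so that \<open>tau_matrix\<close> reads
  \<tau> f = Q f and changing bases becomes matrix multiplication.\<close>

definition mat_act :: "'c poly mat \<Rightarrow> (nat \<Rightarrow> 'm) \<Rightarrow> nat \<Rightarrow> 'm" where
  "mat_act A g i = (\<Sum>j<dim_col A. poly_act scale T (A $$ (i, j)) (g j))"

lemma mat_act_mult:
  assumes "A \<in> carrier_mat m l" "B \<in> carrier_mat l p" "i < m"
  shows "mat_act (A * B) g i = mat_act A (mat_act B g) i"
proof -
  have "mat_act (A * B) g i = (\<Sum>j<p. \<Sum>s<l. poly_act scale T (A $$ (i, s) * B $$ (s, j)) (g j))"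
    unfolding mat_act_def using assms
    by (auto simp: scalar_prod_def T_module.scale_sum_left atLeast0LessThan intro!: sum.cong)
  also have "\<dots> = mat_act A (mat_act B g) i"
    unfolding mat_act_def using assms
    by (subst sum.swap) (auto simp: T_module.scale_sum_right intro!: sum.cong)
  finally show ?thesis .
qed

lemma mat_act_one: "i < m \<Longrightarrow> mat_act (1\<^sub>m m) g i = g i"
proof -
  assume "i < m"
  then have "mat_act (1\<^sub>m m) g i = (\<Sum>j<m. if j = i then g i else 0)"
    unfolding mat_act_def index_one_mat(3) by (intro sum.cong) auto
  with \<open>i < m\<close> show ?thesis by simp
qed

lemma mat_act_cong: "A \<in> carrier_mat m l \<Longrightarrow> (\<And>j. j < l \<Longrightarrow> g j = h j) \<Longrightarrow> mat_act A g i = mat_act A h i"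
  unfolding mat_act_def by (auto intro!: sum.cong)

lemma tau_mat_act:
  assumes ap: "additive_power q TYPE('c)" and A: "A \<in> carrier_mat m l" "i < m"
  shows "\<tau> (mat_act A g i) = mat_act (map_mat (twist q) A) (\<lambda>j. \<tau> (g j)) i"
  unfolding mat_act_def using A by (auto simp: tau_sum tau_poly_act_T[OF ap] intro!: sum.cong)

text \<open>Freeness applied to the rows of A - B. It turns equations between families into
  equations between matrices.\<close>

lemma mat_act_inj:
  assumes f: "free_family scale T {..<l} f" and A: "A \<in> carrier_mat m l" "B \<in> carrier_mat m l"
    and eq: "\<And>i. i < m \<Longrightarrow> mat_act A f i = mat_act B f i"
  shows "A = B"
proof (rule eq_matI)
  fix i j assume ij: "i < dim_row B" "j < dim_col B"
  have "(\<Sum>j<l. poly_act scale T (A $$ (i, j) - B $$ (i, j)) (f j)) = 0"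
    using eq[of i] ij A by (simp add: mat_act_def T_module.scale_left_diff_distrib sum_subtractf)
  from free_family_unique[OF f this, of j] show "A $$ (i, j) = B $$ (i, j)"
    using ij A by simp
qed (use A in auto)

lemma ex_mat_act:
  assumes f: "free_family scale T {..<l} f"
  obtains A where "A \<in> carrier_mat m l" "\<And>i. i < m \<Longrightarrow> g i = mat_act A f i"
proof -
  have "\<forall>i. \<exists>c. g i = (\<Sum>j<l. poly_act scale T (c j) (f j))"
    using f by (simp add: free_family_def)
  then obtain c where c: "\<And>i. g i = (\<Sum>j<l. poly_act scale T (c i j) (f j))"
    by metis
  show ?thesis
  proof
    show "mat m l (\<lambda>(i, j). c i j) \<in> carrier_mat m l" by simp
    show "g i = mat_act (mat m l (\<lambda>(i, j). c i j)) f i" if "i < m" for i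
      using that by (simp add: mat_act_def c[symmetric])
  qed
qed

text \<open>Coefficients form a one-row matrix C. Spanning follows from C = (C B) A, and
  independence from C = (C A) B once C A = 0.\<close>

lemma free_family_mat_act:
  assumes f: "free_family scale T {..<l} f" and A: "A \<in> carrier_mat l l" "B \<in> carrier_mat l l"
    and AB: "A * B = 1\<^sub>m l" "B * A = 1\<^sub>m l"
  shows "free_family scale T {..<l} (mat_act A f)"
  unfolding free_family_def
proof (intro conjI allI impI)
  fix x
  obtain C where C: "C \<in> carrier_mat 1 l" "\<And>i. i < 1 \<Longrightarrow> x = mat_act C f i"
    by (rule ex_mat_act[OF f, where g = "\<lambda>_. x" and m = 1]) blast
  have CB: "C * B \<in> carrier_mat 1 l" using A C by simp
  have "mat_act (C * B) (mat_act A f) 0 = mat_act (C * B * A) f 0"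
    using mat_act_mult[OF CB A(1), of 0] by simp
  also have "C * B * A = C"
    using assoc_mult_mat[OF C(1) A(2,1)] AB C by simp
  finally have "x = (\<Sum>i<l. poly_act scale T ((C * B) $$ (0, i)) (mat_act A f i))"
    using C CB A by (simp add: mat_act_def[of "C * B"])
  then show "\<exists>c. x = (\<Sum>i<l. poly_act scale T (c i) (mat_act A f i))"
    by (intro exI[of _ "\<lambda>i. (C * B) $$ (0, i)"])
next
  fix c assume c: "(\<Sum>i<l. poly_act scale T (c i) (mat_act A f i)) = 0"
  define C where "C = mat 1 l (\<lambda>(i, j). c j)"
  have C: "C \<in> carrier_mat 1 l" by (simp add: C_def)
  have "mat_act (C * A) f 0 = mat_act C (mat_act A f) 0"
    by (rule mat_act_mult[OF C A(1)]) simp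
  also have "\<dots> = 0" unfolding mat_act_def[of C] using c by (simp add: C_def)
  finally have "C * A = 0\<^sub>m 1 l"
    using C A by (intro mat_act_inj[OF f]) (auto simp: mat_act_def[of "0\<^sub>m _ _"])
  then have "C * A * B = 0\<^sub>m 1 l" using A by simp
  then have "C = 0\<^sub>m 1 l"
    using assoc_mult_mat[OF C A] AB C by simp
  then show "\<forall>i\<in>{..<l}. c i = 0"
    unfolding C_def by (auto simp: mat_eq_iff)
qed simp

end

text \<open>Were l < m, padding \<open>U\<close> with zero columns and \<open>V\<close> with zero
  rows up to size \<open>m\<close> would keep the product, yet column \<open>l\<close> of the padded
  \<open>U\<close> would vanish and its determinant with it. Two bases over \<open>T\<close>
  therefore have equally many elements.\<close>

lemma left_inverse_dim_le:
  assumes U: "U \<in> carrier_mat m l" and V: "V \<in> carrier_mat l m"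
    and UV: "U * V = (1\<^sub>m m :: 'a::idom mat)"
  shows "m \<le> l"
proof (rule ccontr)
  assume "\<not> m \<le> l"
  then have lm: "l < m" by simp
  define U' where "U' = mat m m (\<lambda>(i, j). if j < l then U $$ (i, j) else 0)"
  define V' where "V' = mat m m (\<lambda>(i, j). if i < l then V $$ (i, j) else 0)"
  have c: "U' \<in> carrier_mat m m" "V' \<in> carrier_mat m m" by (simp_all add: U'_def V'_def)
  have "U' * V' = U * V"
  proof (rule eq_matI)
    fix i j assume "i < dim_row (U * V)" "j < dim_col (U * V)"
    then have ij: "i < m" "j < m" using U V by auto
    have "(U' * V') $$ (i, j) = (\<Sum>s\<in>{0..<m}. if s < l then U $$ (i, s) * V $$ (s, j) else 0)"
      using ij by (auto simp: U'_def V'_def scalar_prod_def intro!: sum.cong)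
    also have "\<dots> = (\<Sum>s\<in>{0..<l}. U $$ (i, s) * V $$ (s, j))"
      using lm by (intro sum.mono_neutral_cong_right) auto
    also have "\<dots> = (U * V) $$ (i, j)"
      using ij U V by (auto simp: scalar_prod_def intro!: sum.cong)
    finally show "(U' * V') $$ (i, j) = (U * V) $$ (i, j)" .
  qed (use U V c in auto)
  then have "det U' * det V' = 1"
    using det_mult[OF c] UV by simp
  moreover have "det U' = (\<Sum>i<m. U' $$ (i, l) * cofactor U' i l)"
    by (rule laplace_expansion_column[OF c(1) lm])
  then have "det U' = 0"
    using lm by (simp add: U'_def)
  ultimately show False by simp
qed

text \<open>Stated with bare equations for \<open>h\<close>, so that it serves both for
  \<open>twist q\<close> and for the embedding \<open>to_fract\<close> into the fraction
  field.\<close>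

lemma map_mat_mult_hom:
  assumes "h 0 = 0" "\<And>x y. h (x + y) = h x + h y" "\<And>x y. h (x * y) = h x * h y"
    and "A \<in> carrier_mat m l" "B \<in> carrier_mat l p"
  shows "map_mat h (A * B) = map_mat h A * map_mat h B"
proof -
  have "h (\<Sum>i\<in>I. g i) = (\<Sum>i\<in>I. h (g i))" for g :: "nat \<Rightarrow> _" and I
    by (induction I rule: infinite_finite_induct) (simp_all add: assms)
  then show ?thesis
    using assms by (intro eq_matI) (auto simp: scalar_prod_def intro!: sum.cong)
qed

context T_tau_pair
begin

text \<open>Write f = U f0 and f0 = V f, and let a subscript q denote twisting. Then Q = U_q Q0 V,
  and f' = V^t f0' has matrix R = V_q^t R0 U^t. In R Q^t the factors U^t V^t cancel, R0 Q0^t is the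
  scalar \<open>p\<close>, and V_q^t U_q^t cancels.\<close>

lemma dual_matrix_any_basis:
  assumes ap: "additive_power q TYPE('c)"
    and f0: "free_family scale T {..<r} f0" "tau_matrix scale T \<tau> r f0 Q0"
    and f0': "free_family scale' T' {..<r} f0'" "tau_matrix scale' T' \<tau>' r f0' R0"
    and R0Q0: "R0 * transpose_mat Q0 = p \<cdot>\<^sub>m 1\<^sub>m r"
    and f: "free_family scale T {..<m} f" "tau_matrix scale T \<tau> m f Q"
  obtains f' R where "free_family scale' T' {..<m} f'" "tau_matrix scale' T' \<tau>' m f' R"
    "R * transpose_mat Q = p \<cdot>\<^sub>m 1\<^sub>m m"
proof -
  obtain U where U': "U \<in> carrier_mat m r" and f_U: "\<And>i. i < m \<Longrightarrow> f i = M.mat_act U f0 i"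
    using M.ex_mat_act[OF f0(1), of m f] by blast
  obtain V where V': "V \<in> carrier_mat r m" and f0_V: "\<And>i. i < r \<Longrightarrow> f0 i = M.mat_act V f i"
    using M.ex_mat_act[OF f(1), of r f0] by blast
  have UV': "U * V = 1\<^sub>m m"
  proof (rule M.mat_act_inj[OF f(1)])
    fix i assume i: "i < m"
    have "M.mat_act (U * V) f i = M.mat_act U f0 i"
      using M.mat_act_mult[OF U' V' i] M.mat_act_cong[OF U', of f0] f0_V by metis
    then show "M.mat_act (U * V) f i = M.mat_act (1\<^sub>m m) f i"
      using f_U[OF i] i by (simp add: M.mat_act_one)
  qed (use U' V' in auto)
  have VU': "V * U = 1\<^sub>m r"
  proof (rule M.mat_act_inj[OF f0(1)])
    fix i assume i: "i < r"
    have "M.mat_act (V * U) f0 i = M.mat_act V f i"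
      using M.mat_act_mult[OF V' U' i] M.mat_act_cong[OF V', of f] f_U by metis
    then show "M.mat_act (V * U) f0 i = M.mat_act (1\<^sub>m r) f0 i"
      using f0_V[OF i] i by (simp add: M.mat_act_one)
  qed (use U' V' in auto)
  \<comment> \<open>The size of \<open>f\<close> is not given in advance: duality is tested on bases
    of every length, so equality with \<open>r\<close> has to be derived.\<close>
  have mr: "m = r"
    using left_inverse_dim_le[OF U' V' UV'] left_inverse_dim_le[OF V' U' VU'] by simp
  note U = U'[unfolded mr] and V = V'[unfolded mr] and UV = UV'[unfolded mr] and VU = VU'
  let ?tw = "map_mat (twist q)"
  have tw_mult: "?tw (A * B) = ?tw A * ?tw B" if "A \<in> carrier_mat r r" "B \<in> carrier_mat r r"
    for A B :: "'c poly mat"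
    using that
    by (intro map_mat_mult_hom twist_0[OF ap] twist_add[OF ap] twist_mult[OF ap])
  have tw_one: "?tw (1\<^sub>m r) = (1\<^sub>m r :: 'c poly mat)"
    by (rule eq_matI) (auto simp: twist_0[OF ap] twist_1[OF ap])
  have Q0: "Q0 \<in> carrier_mat r r" and tau_f0: "\<And>i. i < r \<Longrightarrow> \<tau> (f0 i) = M.mat_act Q0 f0 i"
    using f0(2) by (auto simp: tau_matrix_def M.mat_act_def)
  have R0: "R0 \<in> carrier_mat r r" and tau_f0': "\<And>i. i < r \<Longrightarrow> \<tau>' (f0' i) = N.mat_act R0 f0' i"
    using f0'(2) by (auto simp: tau_matrix_def N.mat_act_def)
  have Q: "Q \<in> carrier_mat r r" and tau_f: "\<And>i. i < r \<Longrightarrow> \<tau> (f i) = M.mat_act Q f i"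
    using f(2) by (auto simp: tau_matrix_def M.mat_act_def mr)
  define U\<^sub>q where "U\<^sub>q = ?tw U"
  define V\<^sub>q where "V\<^sub>q = ?tw V"
  have Uq: "U\<^sub>q \<in> carrier_mat r r" and Vq: "V\<^sub>q \<in> carrier_mat r r"
    using U V by (simp_all add: U\<^sub>q_def V\<^sub>q_def)
  have UVq: "U\<^sub>q * V\<^sub>q = 1\<^sub>m r"
    unfolding U\<^sub>q_def V\<^sub>q_def by (simp add: tw_mult[OF U V, symmetric] UV tw_one)
  \<comment> \<open>Both sides express \<tau> f in the basis f: \<tau>(U f0) = U_q \<tau> f0 = U_q
    Q0 f0 = U_q Q0 V f.\<close>
  have Q_eq: "Q = U\<^sub>q * Q0 * V"
  proof (rule M.mat_act_inj[OF f(1)[unfolded mr] Q])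
    show "U\<^sub>q * Q0 * V \<in> carrier_mat r r" using Uq Q0 V by simp
    fix i assume i: "i < r"
    have "M.mat_act Q f i = \<tau> (M.mat_act U f0 i)"
      using tau_f[OF i] f_U[of i] i mr by simp
    also have "\<dots> = M.mat_act U\<^sub>q (\<lambda>j. \<tau> (f0 j)) i"
      unfolding U\<^sub>q_def by (rule M.tau_mat_act[OF ap U i])
    also have "\<dots> = M.mat_act U\<^sub>q (M.mat_act Q0 f0) i"
      by (rule M.mat_act_cong[OF Uq tau_f0])
    also have "\<dots> = M.mat_act (U\<^sub>q * Q0) f0 i"
      by (rule M.mat_act_mult[OF Uq Q0 i, symmetric])
    also have "\<dots> = M.mat_act (U\<^sub>q * Q0) (M.mat_act V f) i"
      by (rule M.mat_act_cong[OF mult_carrier_mat[OF Uq Q0] f0_V])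
    also have "\<dots> = M.mat_act (U\<^sub>q * Q0 * V) f i"
      by (rule M.mat_act_mult[OF mult_carrier_mat[OF Uq Q0] V i, symmetric])
    finally show "M.mat_act Q f i = M.mat_act (U\<^sub>q * Q0 * V) f i" .
  qed
  let ?U = "transpose_mat U" and ?V = "transpose_mat V"
  let ?Uq = "transpose_mat U\<^sub>q" and ?Vq = "transpose_mat V\<^sub>q"
  note tc = transpose_carrier_mat[THEN iffD2]
  have UVt: "?U * ?V = 1\<^sub>m r" and VUt: "?V * ?U = 1\<^sub>m r" and VUqt: "?Vq * ?Uq = 1\<^sub>m r"
    by (simp_all flip: transpose_mult[OF V U] transpose_mult[OF U V] transpose_mult[OF Uq Vq]
        add: UV VU UVq)
  define f' where "f' = N.mat_act ?V f0'"
  define R where "R = ?Vq * R0 * ?U"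
  have R: "R \<in> carrier_mat r r" using Vq R0 U by (simp add: R_def)
  have f'_free: "free_family scale' T' {..<r} f'"
    unfolding f'_def using U V by (intro N.free_family_mat_act[OF f0'(1) _ _ VUt UVt]) auto
  have "\<tau>' (f' i) = N.mat_act R f' i" if i: "i < r" for i
  proof -
    have "\<tau>' (f' i) = N.mat_act (?tw ?V) (\<lambda>j. \<tau>' (f0' j)) i"
      unfolding f'_def by (rule N.tau_mat_act[OF ap tc[OF V] i])
    also have "?tw ?V = ?Vq"
      unfolding V\<^sub>q_def by (rule eq_matI) auto
    also have "N.mat_act ?Vq (\<lambda>j. \<tau>' (f0' j)) i = N.mat_act ?Vq (N.mat_act R0 f0') i"
      by (rule N.mat_act_cong[OF tc[OF Vq] tau_f0'])
    also have "\<dots> = N.mat_act (?Vq * R0) f0' i"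
      by (rule N.mat_act_mult[OF tc[OF Vq] R0 i, symmetric])
    also have "\<dots> = N.mat_act (?Vq * R0) (N.mat_act ?U f') i"
    proof (rule N.mat_act_cong[OF mult_carrier_mat[OF tc[OF Vq] R0]])
      fix j assume j: "j < r"
      show "f0' j = N.mat_act ?U f' j"
        unfolding f'_def N.mat_act_mult[OF tc[OF U] tc[OF V] j, symmetric] UVt
        using j by (simp add: N.mat_act_one)
    qed
    also have "\<dots> = N.mat_act R f' i"
      unfolding R_def by (rule N.mat_act_mult[OF mult_carrier_mat[OF tc[OF Vq] R0] tc[OF U] i, symmetric])
    finally show ?thesis .
  qed
  then have tauR: "tau_matrix scale' T' \<tau>' r f' R"
    using R by (simp add: tau_matrix_def N.mat_act_def)
  have cQ: "transpose_mat Q0 \<in> carrier_mat r r" using Q0 by simp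
  have Qt: "transpose_mat Q = ?V * (transpose_mat Q0 * ?Uq)"
    unfolding Q_eq using transpose_mult[OF mult_carrier_mat[OF Uq Q0] V] transpose_mult[OF Uq Q0] by simp
  note cs = tc[OF Vq] R0 tc[OF U] tc[OF V] cQ tc[OF Uq]
  have "R * transpose_mat Q = ?Vq * (R0 * (?U * (?V * (transpose_mat Q0 * ?Uq))))"
    unfolding R_def Qt
    using cs by (simp add: assoc_mult_mat[of _ r r _ r _ r])
  also have "?U * (?V * (transpose_mat Q0 * ?Uq)) = transpose_mat Q0 * ?Uq"
    using assoc_mult_mat[OF tc[OF U] tc[OF V] mult_carrier_mat[OF cQ tc[OF Uq]]] UVt
      left_mult_one_mat[OF mult_carrier_mat[OF cQ tc[OF Uq]]] by simp
  also have "R0 * (transpose_mat Q0 * ?Uq) = (p \<cdot>\<^sub>m 1\<^sub>m r) * ?Uq"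
    using assoc_mult_mat[OF R0 cQ tc[OF Uq]] R0Q0 by simp
  also have "\<dots> = p \<cdot>\<^sub>m ?Uq"
    using mult_smult_assoc_mat[OF one_carrier_mat[of r] tc[OF Uq]] Uq by simp
  also have "?Vq * (p \<cdot>\<^sub>m ?Uq) = p \<cdot>\<^sub>m 1\<^sub>m r"
    using mult_smult_distrib[OF tc[OF Vq] tc[OF Uq]] VUqt by simp
  finally have "R * transpose_mat Q = p \<cdot>\<^sub>m 1\<^sub>m r" .
  then show ?thesis
    using that[of f' R] f'_free tauR by (simp add: mr)
qed

lemma is_dual_if_canonical_bases:
  assumes ap: "additive_power q TYPE('c)"
    and M: "abelian_T_motive q \<theta> scale T \<tau>" and N: "abelian_T_motive q \<theta> scale' T' \<tau>'"
    and f0: "free_family scale T {..<r} f0" "tau_matrix scale T \<tau> r f0 Q0"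
    and f0': "free_family scale' T' {..<r} f0'" "tau_matrix scale' T' \<tau>' r f0' R0"
    and R0Q0: "R0 * transpose_mat Q0 = [:- \<theta>, 1:] \<cdot>\<^sub>m 1\<^sub>m r"
  shows "is_dual_T_motive q \<theta> scale T \<tau> scale' T' \<tau>'"
  unfolding is_dual_T_motive_def
proof (intro conjI M N allI impI)
  fix m f Q
  assume "is_basis scale T {..<m} f \<and> tau_matrix scale T \<tau> m f Q"
  then have f: "free_family scale T {..<m} f" "tau_matrix scale T \<tau> m f Q"
    by (auto simp: is_basis_free_family)
  obtain f' R where f': "free_family scale' T' {..<m} f'" "tau_matrix scale' T' \<tau>' m f' R"
    and RQ: "R * transpose_mat Q = [:- \<theta>, 1:] \<cdot>\<^sub>m 1\<^sub>m m"
    using dual_matrix_any_basis[OF ap f0 f0' R0Q0 f] by blast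
  have Q: "transpose_mat Q \<in> carrier_mat m m" and R: "R \<in> carrier_mat m m"
    using f(2) f'(2) by (auto simp: tau_matrix_def)
  let ?p = "to_fract [:- \<theta>, 1:]"
  let ?F = "map_mat to_fract :: 'c poly mat \<Rightarrow> _"
  \<comment> \<open>Over C(T) the identity R Q^t = T - \<theta> makes this a left inverse of Q^t;
    since the matrices are square over a field, it is also a right inverse.\<close>
  define P where "P = inverse ?p \<cdot>\<^sub>m ?F R"
  have p: "?p \<noteq> 0" by simp
  have P: "P \<in> carrier_mat m m" using R by (simp add: P_def)
  have FQ: "?F (transpose_mat Q) \<in> carrier_mat m m" and FR: "?F R \<in> carrier_mat m m"
    using Q R by simp_all
  have "?F R * ?F (transpose_mat Q) = ?F ([:- \<theta>, 1:] \<cdot>\<^sub>m 1\<^sub>m m)"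
    unfolding RQ[symmetric]
    by (rule map_mat_mult_hom[OF _ _ _ R Q, symmetric]) simp_all
  also have "\<dots> = ?p \<cdot>\<^sub>m 1\<^sub>m m"
    by (rule eq_matI) (auto simp del: to_fract_diff)
  finally have "P * ?F (transpose_mat Q) = inverse ?p \<cdot>\<^sub>m (?p \<cdot>\<^sub>m 1\<^sub>m m)"
    unfolding P_def using mult_smult_assoc_mat[OF FR FQ] by simp
  also have "\<dots> = 1\<^sub>m m"
    using p by (intro eq_matI) auto
  finally have PQ: "P * ?F (transpose_mat Q) = 1\<^sub>m m" .
  have QP: "?F (transpose_mat Q) * P = 1\<^sub>m m"
    by (rule mat_mult_left_right_inverse[OF P FQ PQ])
  have "?F R = ?p \<cdot>\<^sub>m P"
    unfolding P_def using p by (intro eq_matI) auto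
  then show "\<exists>f' R P. is_basis scale' T' {..<m} f' \<and> tau_matrix scale' T' \<tau>' m f' R \<and>
      P \<in> carrier_mat m m \<and> inverts_mat P (?F (transpose_mat Q)) \<and>
      inverts_mat (?F (transpose_mat Q)) P \<and> ?F R = ?p \<cdot>\<^sub>m P"
    using f' P PQ QP Q by (intro exI[of _ f'] exI[of _ R] exI[of _ P])
      (auto simp: is_basis_free_family inverts_mat_def)
qed

end

section \<open>The matrices of \<open>\<tau>\<close> on the motive and on its dual\<close>

definition motive_index :: "nat \<Rightarrow> (nat \<Rightarrow> nat) \<Rightarrow> (nat \<times> nat) set" where
  "motive_index n k = Sigma {1..n} (\<lambda>i. {..<k i})"

text \<open>Row (i, m) gives \<tau> f(i,m) = f(i,m+1), except in the top row m = k(i) - 1, which is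
  the formula for T e(i) solved for its term \<tau>^k(i) e(i).\<close>

fun motive_matrix ::
  "(nat \<Rightarrow> nat) \<Rightarrow> 'c::field \<Rightarrow> (nat \<Rightarrow> nat \<Rightarrow> nat \<Rightarrow> 'c) \<Rightarrow> nat \<times> nat \<Rightarrow> nat \<times> nat \<Rightarrow> 'c poly" where
  "motive_matrix k \<theta> a (i, m) (\<beta>, l) =
     (if Suc m = k i then if l = 0 then if \<beta> = i then [:- \<theta>, 1:] else 0 else [:- a l i \<beta>:]
      else if (\<beta>, l) = (i, Suc m) then 1 else 0)"

text \<open>Row (i, m) below the top is the relation for \<open>T\<close> on f'(i,m+1) solved for
  \<tau> f'(i,m); the top row says that \<tau> f'(i,k(i)-1) is f'(i,0).\<close>

fun dual_matrix ::
  "(nat \<Rightarrow> nat) \<Rightarrow> 'c::field \<Rightarrow> (nat \<Rightarrow> nat \<Rightarrow> nat \<Rightarrow> 'c) \<Rightarrow> nat \<times> nat \<Rightarrow> nat \<times> nat \<Rightarrow> 'c poly" where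
  "dual_matrix k \<theta> a (i, m) (\<beta>, l) =
     (if Suc m = k i then if (\<beta>, l) = (i, 0) then 1 else 0
      else if l = 0 then [:a (Suc m) \<beta> i:] else if (\<beta>, l) = (i, Suc m) then [:- \<theta>, 1:] else 0)"

lemma finite_motive_index [simp]: "finite (motive_index n k)"
  by (simp add: motive_index_def)

text \<open>This is R Q^t = T - \<theta>, entry by entry. A top row of R selects column (i, 0) of Q,
  whose only entry is T - \<theta> in the top row of \<open>i\<close>. For another row, column (i,
  m+1) of Q gives the diagonal term and, when \<open>u\<close> is a top row, also -a(m+1,j,i) (T -
  \<theta>), which the contribution of column (j, 0) cancels.\<close>

lemma dual_matrix_mult_motive_matrix:
  assumes s: "s \<in> motive_index n k" and u: "u \<in> motive_index n k"
  shows "(\<Sum>t\<in>motive_index n k. dual_matrix k \<theta> a s t * motive_matrix k \<theta> a u t)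
    = (if s = u then [:- \<theta>, 1:] else 0)"
proof -
  obtain i m j w where su: "s = (i, m)" "u = (j, w)" by fastforce
  have i: "i \<in> {1..n}" "m < k i" and j: "j \<in> {1..n}" "w < k j"
    using s u by (auto simp: su motive_index_def)
  let ?X = "[:- \<theta>, 1:]"
  show ?thesis
  proof (cases "Suc m = k i")
    case True
    have "(\<Sum>t\<in>motive_index n k. dual_matrix k \<theta> a s t * motive_matrix k \<theta> a u t)
      = (\<Sum>t\<in>motive_index n k. if t = (i, 0) then motive_matrix k \<theta> a u t else 0)"
      using True by (intro sum.cong) (auto simp: su split: prod.splits if_splits)
    also have "\<dots> = motive_matrix k \<theta> a u (i, 0)"
      using i by (simp add: motive_index_def)
    also have "\<dots> = (if s = u then ?X else 0)"
      using True j by (auto simp: su)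
    finally show ?thesis .
  next
    case False
    have "(\<Sum>t\<in>motive_index n k. dual_matrix k \<theta> a s t * motive_matrix k \<theta> a u t)
      = (\<Sum>t\<in>motive_index n k. (if t = (i, Suc m) then ?X * motive_matrix k \<theta> a u t else 0)
          + (if t = (j, 0) then if Suc w = k j then [:a (Suc m) j i:] * ?X else 0 else 0))"
      using False by (intro sum.cong) (auto simp: su split: prod.splits if_splits)
    also have "\<dots> = ?X * motive_matrix k \<theta> a u (i, Suc m)
        + (if Suc w = k j then [:a (Suc m) j i:] * ?X else 0)"
      using i j False by (simp add: sum.distrib motive_index_def)
    also have "\<dots> = (if s = u then ?X else 0)"
      using False by (auto simp: su algebra_simps)
    finally show ?thesis .
  qed
qed

context T_tau_module
begin

lemma poly_act_T_minus: "poly_act scale T [:- \<theta>, 1:] x = T x - scale \<theta> x"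
  by (simp add: poly_act_pCons)

text \<open>The family is arbitrary because the formula is applied twice: to the powers of \<tau> in
  M and to the unit vectors of the model.\<close>

lemma motive_matrix_row:
  assumes s: "(i, m) \<in> motive_index n k" and k: "\<And>i. i \<in> {1..n} \<Longrightarrow> k i > 0"
  shows "(\<Sum>t\<in>motive_index n k. poly_act scale T (motive_matrix k \<theta> a (i, m) t) (f t))
    = (if Suc m = k i then T (f (i, 0)) - scale \<theta> (f (i, 0))
         - (\<Sum>\<alpha>=1..n. \<Sum>j=1..k \<alpha> - 1. scale (a j i \<alpha>) (f (\<alpha>, j)))
       else f (i, Suc m))"
proof (cases "Suc m = k i")
  case True
  have i: "i \<in> {1..n}" using s by (auto simp: motive_index_def)
  have "(\<Sum>t\<in>motive_index n k. poly_act scale T (motive_matrix k \<theta> a (i, m) t) (f t))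
    = (\<Sum>\<alpha>=1..n. \<Sum>l<k \<alpha>. poly_act scale T (motive_matrix k \<theta> a (i, m) (\<alpha>, l)) (f (\<alpha>, l)))"
    unfolding motive_index_def
    by (subst sum.Sigma) (auto simp: split_def simp del: motive_matrix.simps)
  also have "\<dots> = (\<Sum>\<alpha>=1..n. (if \<alpha> = i then T (f (i, 0)) - scale \<theta> (f (i, 0)) else 0)
      - (\<Sum>j=1..k \<alpha> - 1. scale (a j i \<alpha>) (f (\<alpha>, j))))"
  proof (rule sum.cong)
    fix \<alpha> assume \<alpha>: "\<alpha> \<in> {1..n}"
    \<comment> \<open>Position 0 is split off since it carries the entry T - \<theta>, while the
      coefficients a start at j = 1.\<close>
    have "{..<k \<alpha>} = insert 0 {1..k \<alpha> - 1}"
      using k[OF \<alpha>] by auto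
    moreover have "(\<Sum>l=1..k \<alpha> - 1. poly_act scale T (motive_matrix k \<theta> a (i, m) (\<alpha>, l)) (f (\<alpha>, l)))
      = (\<Sum>l=1..k \<alpha> - 1. - scale (a l i \<alpha>) (f (\<alpha>, l)))"
      using True by (intro sum.cong) (auto simp: poly_act_pCons)
    ultimately show "(\<Sum>l<k \<alpha>. poly_act scale T (motive_matrix k \<theta> a (i, m) (\<alpha>, l)) (f (\<alpha>, l)))
      = (if \<alpha> = i then T (f (i, 0)) - scale \<theta> (f (i, 0)) else 0)
      - (\<Sum>j=1..k \<alpha> - 1. scale (a j i \<alpha>) (f (\<alpha>, j)))"
      using True by (simp add: sum_negf poly_act_T_minus)
  qed simp
  also have "\<dots> = T (f (i, 0)) - scale \<theta> (f (i, 0))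
      - (\<Sum>\<alpha>=1..n. \<Sum>j=1..k \<alpha> - 1. scale (a j i \<alpha>) (f (\<alpha>, j)))"
    using i by (simp add: sum_subtractf)
  finally show ?thesis using True by simp
next
  case False
  have "(\<Sum>t\<in>motive_index n k. poly_act scale T (motive_matrix k \<theta> a (i, m) t) (f t))
    = (\<Sum>t\<in>motive_index n k. if t = (i, Suc m) then f (i, Suc m) else 0)"
    using False by (intro sum.cong) (auto split: prod.splits if_splits)
  then show ?thesis using s False by (simp add: motive_index_def)
qed

text \<open>Again for an arbitrary family, to be used both in M(B) and in its model.\<close>

lemma dual_matrix_row:
  assumes s: "(i, m) \<in> motive_index n k" and k: "\<And>i. i \<in> {1..n} \<Longrightarrow> k i > 0"
  shows "(\<Sum>t\<in>motive_index n k. poly_act scale T (dual_matrix k \<theta> a (i, m) t) (f t))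
    = (if Suc m = k i then f (i, 0)
       else T (f (i, Suc m)) - scale \<theta> (f (i, Suc m)) + (\<Sum>\<alpha>=1..n. scale (a (Suc m) \<alpha> i) (f (\<alpha>, 0))))"
proof (cases "Suc m = k i")
  case True
  have "(\<Sum>t\<in>motive_index n k. poly_act scale T (dual_matrix k \<theta> a (i, m) t) (f t))
    = (\<Sum>t\<in>motive_index n k. if t = (i, 0) then f (i, 0) else 0)"
    using True by (intro sum.cong) (auto split: prod.splits if_splits)
  then show ?thesis using s True by (simp add: motive_index_def)
next
  case False
  let ?y = "T (f (i, Suc m)) - scale \<theta> (f (i, Suc m))"
  have "(\<Sum>t\<in>motive_index n k. poly_act scale T (dual_matrix k \<theta> a (i, m) t) (f t))
    = (\<Sum>t\<in>motive_index n k. (if t = (i, Suc m) then ?y else 0)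
        + (if snd t = 0 then scale (a (Suc m) (fst t) i) (f t) else 0))"
    using False by (intro sum.cong) (auto simp: poly_act_pCons split: prod.splits if_splits)
  also have "\<dots> = ?y + (\<Sum>t\<in>motive_index n k. if snd t = 0 then scale (a (Suc m) (fst t) i) (f t) else 0)"
    using s False by (simp add: sum.distrib motive_index_def)
  also have "(\<Sum>t\<in>motive_index n k. if snd t = 0 then scale (a (Suc m) (fst t) i) (f t) else 0)
    = (\<Sum>\<alpha>=1..n. \<Sum>l<k \<alpha>. if l = 0 then scale (a (Suc m) \<alpha> i) (f (\<alpha>, l)) else 0)"
    unfolding motive_index_def by (subst sum.Sigma) (auto intro!: sum.cong)
  also have "\<dots> = (\<Sum>\<alpha>=1..n. scale (a (Suc m) \<alpha> i) (f (\<alpha>, 0)))"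
    using k by (intro sum.cong) auto
  finally show ?thesis using False by simp
qed

end

section \<open>Bases over \<open>T\<close>\<close>

text \<open>In the model e(i) corresponds to the unit vector at (i, 0). The rows below the top move
  it through the positions (i, j), and the top row is the relation for T e(i), which therefore also
  holds in the model.\<close>

lemma motive_T_basis:
  fixes scale :: "'c::field \<Rightarrow> 'm::ab_group_add \<Rightarrow> 'm"
  assumes M: "T_tau_module scale q T \<tau>" and ap: "additive_power q TYPE('c)"
    and k: "\<And>i. i \<in> {1..n} \<Longrightarrow> k i > 0"
    and e: "free_family scale \<tau> {1..n} e"
    and T_e: "\<forall>i\<in>{1..n}. T (e i) = scale \<theta> (e i)
                + (\<Sum>\<alpha>=1..n. \<Sum>j=1..k \<alpha> - 1. scale (a j i \<alpha>) ((\<tau> ^^ j) (e \<alpha>)))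
                + (\<tau> ^^ k i) (e i)"
  defines "f \<equiv> \<lambda>(i, j). (\<tau> ^^ j) (e i)"
  shows "free_family scale T (motive_index n k) f"
    and "s \<in> motive_index n k \<Longrightarrow>
      \<tau> (f s) = (\<Sum>t\<in>motive_index n k. poly_act scale T (motive_matrix k \<theta> a s t) (f t))"
proof -
  interpret T_tau_module scale q T \<tau> by fact
  let ?D = "motive_index n k" and ?Q = "motive_matrix k \<theta> a"
  have f_ij: "f (i, j) = (\<tau> ^^ j) (e i)" for i j by (simp add: f_def)
  have tau_f: "\<tau> (f s) = (\<Sum>t\<in>?D. poly_act scale T (?Q s t) (f t))" if s: "s \<in> ?D" for s
  proof -
    obtain i m where im: "s = (i, m)" by fastforce
    have i: "i \<in> {1..n}" using s by (auto simp: im motive_index_def)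
    have "\<tau> (f s) = (\<tau> ^^ Suc m) (e i)" by (simp add: im f_def)
    then show ?thesis
      using T_e[rule_format, OF i] motive_matrix_row[OF s[unfolded im] k, of \<theta> a f]
      by (cases "Suc m = k i") (simp_all add: im f_ij)
  qed
  then show "s \<in> ?D \<Longrightarrow> \<tau> (f s) = (\<Sum>t\<in>?D. poly_act scale T (?Q s t) (f t))" .
  interpret N: T_tau_module "vec_scale :: 'c \<Rightarrow> (nat \<times> nat \<Rightarrow> 'c poly) \<Rightarrow> _" q vec_T "vec_tau q ?D ?Q"
    by (rule T_tau_module_vec[OF ap])
  let ?u = "vec_unit :: nat \<times> nat \<Rightarrow> nat \<times> nat \<Rightarrow> 'c poly"
  have tau_u: "vec_tau q ?D ?Q (?u (i, m)) = (if Suc m = k i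
      then vec_T (?u (i, 0)) - vec_scale \<theta> (?u (i, 0))
         - (\<Sum>\<alpha>=1..n. \<Sum>j=1..k \<alpha> - 1. vec_scale (a j i \<alpha>) (?u (\<alpha>, j)))
       else ?u (i, Suc m))" if "(i, m) \<in> ?D" for i m
    unfolding vec_tau_unit[OF ap finite_motive_index that] by (rule N.motive_matrix_row[OF that k])
  have pow: "\<Phi> ((\<tau> ^^ j) (e i)) = ?u (i, j)"
    if "i \<in> {1..n}" "j < k i" and e: "\<forall>i\<in>{1..n}. \<Phi> (e i) = ?u (i, 0)"
      and tau: "\<forall>x. \<Phi> (\<tau> x) = vec_tau q ?D ?Q (\<Phi> x)" for \<Phi> i j
    using that(2)
  proof (induction j)
    case 0
    then show ?case using e that(1) by simp
  next
    case (Suc j)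
    then have "(i, j) \<in> ?D" using that(1) by (simp add: motive_index_def)
    from tau_u[OF this] show ?case using Suc tau by simp
  qed
  show "free_family scale T ?D f"
  proof (rule free_family_if_model[OF M ap e finite_motive_index _ tau_f, where \<sigma> = "\<lambda>i. (i, 0)"])
    show "(i, 0) \<in> ?D \<and> e i = f (i, 0)" if "i \<in> {1..n}" for i
      using that k by (auto simp: motive_index_def f_def)
    fix \<Phi> :: "'m \<Rightarrow> nat \<times> nat \<Rightarrow> 'c poly"
    assume \<Phi>_e: "\<forall>i\<in>{1..n}. \<Phi> (e i) = ?u (i, 0)"
      and tau: "\<forall>x. \<Phi> (\<tau> x) = vec_tau q ?D ?Q (\<Phi> x)"
    show "\<Phi> (f s) = ?u s" if "s \<in> ?D" for s
      using that pow[OF _ _ \<Phi>_e tau] by (auto simp: f_def motive_index_def)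
    fix i assume i: "i \<in> {1..n}"
      and add: "\<forall>x y. \<Phi> (x + y) = \<Phi> x + \<Phi> y" and scl: "\<forall>c x. \<Phi> (scale c x) = vec_scale c (\<Phi> x)"
    \<comment> \<open>At the top position \<open>m\<close> one more \<tau> no longer yields a unit
      vector but the top row of the matrix.\<close>
    obtain m where m: "k i = Suc m" using k[OF i] by (cases "k i") auto
    have im: "(i, m) \<in> ?D" using i m by (simp add: motive_index_def)
    have "\<Phi> ((\<tau> ^^ k i) (e i)) = vec_tau q ?D ?Q (?u (i, m))"
      using tau pow[OF i _ \<Phi>_e tau, of m] m by simp
    moreover have "\<Phi> (\<Sum>\<alpha>=1..n. \<Sum>j=1..k \<alpha> - 1. scale (a j i \<alpha>) ((\<tau> ^^ j) (e \<alpha>)))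
        = (\<Sum>\<alpha>=1..n. \<Sum>j=1..k \<alpha> - 1. vec_scale (a j i \<alpha>) (?u (\<alpha>, j)))"
      unfolding additive_sum[OF add] using scl pow[OF _ _ \<Phi>_e tau]
      by (intro sum.cong) auto
    ultimately show "\<Phi> (T (e i)) = vec_T (?u (i, 0))"
      using T_e[rule_format, OF i] add scl \<Phi>_e i m tau_u[OF im] by simp
  qed
qed

text \<open>The \<tau>-generators occupy the positions with j > 0. Position (i, 0) is filled by
  \<tau> of the top generator, and k(i) > 1 keeps the top position apart from (i, 0). For m = 0 the
  term \<tau> f(i,m) is thus a second power of \<tau>.\<close>

lemma dual_T_basis:
  fixes scale :: "'c::field \<Rightarrow> 'm::ab_group_add \<Rightarrow> 'm" and E :: "nat \<times> nat \<Rightarrow> 'm"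
  assumes M: "T_tau_module scale q T \<tau>" and ap: "additive_power q TYPE('c)"
    and k: "\<And>i. i \<in> {1..n} \<Longrightarrow> k i > 1"
    and E: "free_family scale \<tau> {(i, j). (i, j) \<in> motive_index n k \<and> j > 0} E"
  defines "f \<equiv> \<lambda>(i, j). if j = 0 then \<tau> (E (i, k i - 1)) else E (i, j)"
  assumes T_E: "\<And>i m. i \<in> {1..n} \<Longrightarrow> Suc m < k i \<Longrightarrow> T (E (i, Suc m)) = scale \<theta> (E (i, Suc m))
                + \<tau> (f (i, m)) - (\<Sum>\<alpha>=1..n. scale (a (Suc m) \<alpha> i) (f (\<alpha>, 0)))"
  shows "free_family scale T (motive_index n k) f"
    and "s \<in> motive_index n k \<Longrightarrow>
      \<tau> (f s) = (\<Sum>t\<in>motive_index n k. poly_act scale T (dual_matrix k \<theta> a s t) (f t))"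
proof -
  interpret T_tau_module scale q T \<tau> by fact
  let ?D = "motive_index n k" and ?R = "dual_matrix k \<theta> a"
  have f_Suc: "f (i, Suc m) = E (i, Suc m)" for i m by (simp add: f_def)
  have k0: "\<And>i. i \<in> {1..n} \<Longrightarrow> k i > 0" using k by force
  have tau_f: "\<tau> (f s) = (\<Sum>t\<in>?D. poly_act scale T (?R s t) (f t))" if s: "s \<in> ?D" for s
  proof -
    obtain i m where im: "s = (i, m)" by fastforce
    have i: "i \<in> {1..n}" "m < k i" using s by (auto simp: im motive_index_def)
    show ?thesis
    proof (cases "Suc m = k i")
      case True
      then have "\<tau> (f s) = f (i, 0)"
        using k[OF i(1)] by (auto simp: im f_def True[symmetric])
      then show ?thesis
        using dual_matrix_row[OF s[unfolded im] k0, of \<theta> a f] True by (simp add: im)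
    next
      case False
      then have "Suc m < k i" using i by simp
      from T_E[OF i(1) this] show ?thesis
        using dual_matrix_row[OF s[unfolded im] k0, of \<theta> a f] False
        by (simp add: im f_Suc)
    qed
  qed
  then show "s \<in> ?D \<Longrightarrow> \<tau> (f s) = (\<Sum>t\<in>?D. poly_act scale T (?R s t) (f t))" .
  interpret N: T_tau_module "vec_scale :: 'c \<Rightarrow> (nat \<times> nat \<Rightarrow> 'c poly) \<Rightarrow> _" q vec_T "vec_tau q ?D ?R"
    by (rule T_tau_module_vec[OF ap])
  let ?u = "vec_unit :: nat \<times> nat \<Rightarrow> nat \<times> nat \<Rightarrow> 'c poly"
  have tau_u: "vec_tau q ?D ?R (?u (i, m)) = (if Suc m = k i then ?u (i, 0)
       else vec_T (?u (i, Suc m)) - vec_scale \<theta> (?u (i, Suc m))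
         + (\<Sum>\<alpha>=1..n. vec_scale (a (Suc m) \<alpha> i) (?u (\<alpha>, 0))))" if "(i, m) \<in> ?D" for i m
    unfolding vec_tau_unit[OF ap finite_motive_index that] by (rule N.dual_matrix_row[OF that k0])
  let ?D1 = "{(i, j). (i, j) \<in> ?D \<and> j > 0}"
  have \<Phi>_f: "\<Phi> (f s) = ?u s" if s: "s \<in> ?D" and \<Phi>_E: "\<forall>s\<in>?D1. \<Phi> (E s) = ?u s"
    and tau: "\<forall>x. \<Phi> (\<tau> x) = vec_tau q ?D ?R (\<Phi> x)" for \<Phi> s
  proof -
    obtain i m where im: "s = (i, m)" by fastforce
    have i: "i \<in> {1..n}" "m < k i" using s by (auto simp: im motive_index_def)
    show ?thesis
    proof (cases "m = 0")
      case True
      have "(i, k i - 1) \<in> ?D1" using i k[OF i(1)] by (simp add: motive_index_def)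
      then have "\<Phi> (f s) = vec_tau q ?D ?R (?u (i, k i - 1))" and "(i, k i - 1) \<in> ?D"
        using \<Phi>_E True tau by (auto simp: im f_def)
      then show ?thesis using tau_u[of i "k i - 1"] k[OF i(1)] by (simp add: im True)
    next
      case False
      then show ?thesis using \<Phi>_E s by (auto simp: im f_def)
    qed
  qed
  show "free_family scale T ?D f"
  proof (rule free_family_if_model[OF M ap E finite_motive_index _ tau_f, where \<sigma> = "\<lambda>s. s"])
    show "s \<in> ?D \<and> E s = f s" if "s \<in> ?D1" for s
      using that by (auto simp: f_def)
    fix \<Phi> :: "'m \<Rightarrow> nat \<times> nat \<Rightarrow> 'c poly"
    assume \<Phi>_E: "\<forall>s\<in>?D1. \<Phi> (E s) = ?u s"
      and tau: "\<forall>x. \<Phi> (\<tau> x) = vec_tau q ?D ?R (\<Phi> x)"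
    show "\<Phi> (f s) = ?u s" if "s \<in> ?D" for s
      by (rule \<Phi>_f[OF that \<Phi>_E tau])
    fix s assume s: "s \<in> ?D1"
      and add: "\<forall>x y. \<Phi> (x + y) = \<Phi> x + \<Phi> y" and scl: "\<forall>c x. \<Phi> (scale c x) = vec_scale c (\<Phi> x)"
    obtain i m where im: "s = (i, Suc m)" using s by (auto simp: gr0_conv_Suc)
    have i: "i \<in> {1..n}" "Suc m < k i" using s by (auto simp: im motive_index_def)
    have im_D: "(i, m) \<in> ?D" using i by (simp add: motive_index_def)
    have diff: "\<Phi> (x - y) = \<Phi> x - \<Phi> y" for x y
      using add[rule_format, of "x - y" y] by simp
    have "\<Phi> (\<Sum>\<alpha>=1..n. scale (a (Suc m) \<alpha> i) (f (\<alpha>, 0)))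
        = (\<Sum>\<alpha>=1..n. vec_scale (a (Suc m) \<alpha> i) (?u (\<alpha>, 0)))"
      unfolding additive_sum[OF add] using scl \<Phi>_f[OF _ \<Phi>_E tau] k0
      by (intro sum.cong) (auto simp: motive_index_def)
    moreover have "\<Phi> (\<tau> (f (i, m))) = vec_tau q ?D ?R (?u (i, m))"
      using tau \<Phi>_f[OF im_D \<Phi>_E tau] by simp
    moreover have "\<Phi> (E (i, Suc m)) = ?u (i, Suc m)"
      using \<Phi>_E s im by auto
    ultimately show "\<Phi> (T (E s)) = vec_T (?u s)"
      unfolding im T_E[OF i] using add scl tau_u[OF im_D] i by (simp add: diff)
  qed
qed

lemma tau_matrix_reindex:
  assumes \<pi>: "bij_betw \<pi> {..<m} D"
    and tau: "\<And>s. s \<in> D \<Longrightarrow> \<tau> (f s) = (\<Sum>t\<in>D. poly_act scale T (Q s t) (f t))"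
  shows "tau_matrix scale T \<tau> m (\<lambda>x. f (\<pi> x)) (mat m m (\<lambda>(x, y). Q (\<pi> x) (\<pi> y)))"
  unfolding tau_matrix_def
proof (intro conjI allI impI)
  fix x assume x: "x < m"
  then have "\<tau> (f (\<pi> x)) = (\<Sum>t\<in>D. poly_act scale T (Q (\<pi> x) t) (f t))"
    using bij_betwE[OF \<pi>] by (intro tau) auto
  also have "\<dots> = (\<Sum>y<m. poly_act scale T (Q (\<pi> x) (\<pi> y)) (f (\<pi> y)))"
    by (rule sum.reindex_bij_betw[OF \<pi>, symmetric])
  finally show "\<tau> (f (\<pi> x))
      = (\<Sum>y<m. poly_act scale T (mat m m (\<lambda>(x, y). Q (\<pi> x) (\<pi> y)) $$ (x, y)) (f (\<pi> y)))"
    using x by simp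
qed simp

lemma ex_is_basis_lessThan:
  assumes "free_family scale \<phi> J h"
  shows "\<exists>m g. is_basis scale \<phi> {..<m} g"
proof -
  obtain \<pi> where \<pi>: "bij_betw \<pi> {..<card J} J"
    using assms ex_bij_betw_nat_finite[of J] by (auto simp: free_family_def atLeast0LessThan)
  from free_family_reindex[OF assms \<pi>] show ?thesis
    by (auto simp: is_basis_free_family)
qed

lemma abelian_T_motiveI:
  fixes scale :: "'c::field \<Rightarrow> 'm::ab_group_add \<Rightarrow> 'm"
  assumes M: "T_tau_module scale q T \<tau>" and perfect: "\<And>c :: 'c. \<exists>b. b ^ q = c"
    and f: "free_family scale T D f" and e: "free_family scale \<tau> I e"
    and gen: "\<And>i. i \<in> I \<Longrightarrow> T (e i) - scale \<theta> (e i) \<in> range \<tau>"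
  shows "abelian_T_motive q \<theta> scale T \<tau>"
proof -
  interpret T_tau_module scale q T \<tau> by fact
  \<comment> \<open>The exponent 1 suffices, as T - \<theta> already kills M / \<tau>M.\<close>
  have "((\<lambda>y. T y - scale \<theta> y) ^^ 1) x \<in> range \<tau>" for x
    using T_minus_theta_in_range_tau[OF e subspace_range_tau[OF perfect] gen] by simp
  then show ?thesis
    unfolding abelian_T_motive_def using M ex_is_basis_lessThan[OF f] ex_is_basis_lessThan[OF e] by blast
qed

theorem theorem11p5:
  fixes \<iota> :: "'f::{field,finite} fls \<Rightarrow> 'c::{field,metric_space}"
    and q n r :: nat and \<theta> :: 'c
    and k :: "nat \<Rightarrow> nat"
    and a :: "nat \<Rightarrow> nat \<Rightarrow> nat \<Rightarrow> 'c"
    and scale :: "'c \<Rightarrow> 'm::ab_group_add \<Rightarrow> 'm" and T \<tau> :: "'m \<Rightarrow> 'm"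
    and e :: "nat \<Rightarrow> 'm"
    and \<nu> :: "nat \<times> nat \<Rightarrow> nat"
    and B1 B2 :: "nat \<Rightarrow> nat \<Rightarrow> 'c"
    and scale' :: "'c \<Rightarrow> 'n::ab_group_add \<Rightarrow> 'n" and T' \<tau>' :: "'n \<Rightarrow> 'n"
    and e' :: "nat \<Rightarrow> 'n"
  assumes C_inf: "is_C_infinity \<iota>"
    and q: "q = CARD('f)"
    and theta: "\<theta> = C_infinity_theta \<iota>"
    and n: "n \<ge> 1"
    and k_decr: "\<forall>i\<in>{1..<n}. k (i + 1) \<le> k i"
    and k_ge: "k n \<ge> 3"
    and r: "r = (\<Sum>i=1..n. k i)"
    and M: "T_tau_module scale q T \<tau>"
    and e_basis: "is_basis scale \<tau> {1..n} e"
    and T_e: "\<forall>i\<in>{1..n}. T (e i) = scale \<theta> (e i)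
                + (\<Sum>\<alpha>=1..n. \<Sum>j=1..k \<alpha> - 1. scale (a j i \<alpha>) ((\<tau> ^^ j) (e \<alpha>)))
                + (\<tau> ^^ k i) (e i)"
    and nu: "bij_betw \<nu> {(i, j). i \<in> {1..n} \<and> j \<in> {1..k i - 2}} {n + 1..r - n}"
    and B1_1: "\<forall>i\<in>{1..n}. \<forall>\<alpha>\<in>{1..n}. B1 i \<alpha> = - a (k i - 1) \<alpha> i"
    and B1_2: "\<forall>i\<in>{1..n}. \<forall>\<alpha>\<in>{1..n}. \<forall>j\<in>{1..k i - 2}. B1 (\<nu> (i, j)) \<alpha> = - a j \<alpha> i"
    and B1_3: "\<forall>i\<in>{1..n}. \<forall>j\<in>{1..k i - 3}. B1 (\<nu> (i, j + 1)) (\<nu> (i, j)) = 1"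
    and B1_4: "\<forall>i\<in>{1..n}. B1 i (\<nu> (i, k i - 2)) = 1"
    and B1_0: "\<forall>\<gamma>\<in>{1..r - n}. \<forall>\<delta>\<in>{1..r - n}.
                 (\<gamma>, \<delta>) \<notin> {(i, \<alpha>) | i \<alpha>. i \<in> {1..n} \<and> \<alpha> \<in> {1..n}}
                        \<union> {(\<nu> (i, j), \<alpha>) | i j \<alpha>. i \<in> {1..n} \<and> \<alpha> \<in> {1..n} \<and> j \<in> {1..k i - 2}}
                        \<union> {(\<nu> (i, j + 1), \<nu> (i, j)) | i j. i \<in> {1..n} \<and> j \<in> {1..k i - 3}}
                        \<union> {(i, \<nu> (i, k i - 2)) | i. i \<in> {1..n}}
                 \<longrightarrow> B1 \<gamma> \<delta> = 0"
    and B2_1: "\<forall>i\<in>{1..n}. B2 (\<nu> (i, 1)) i = 1"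
    and B2_0: "\<forall>\<gamma>\<in>{1..r - n}. \<forall>\<delta>\<in>{1..r - n}.
                 (\<gamma>, \<delta>) \<notin> {(\<nu> (i, 1), i) | i. i \<in> {1..n}} \<longrightarrow> B2 \<gamma> \<delta> = 0"
    and MB: "T_tau_module scale' q T' \<tau>'"
    and e'_basis: "is_basis scale' \<tau>' {1..r - n} e'"
    and T_e': "\<forall>\<gamma>\<in>{1..r - n}. T' (e' \<gamma>) = scale' \<theta> (e' \<gamma>)
                 + (\<Sum>\<delta>=1..r - n. scale' (B1 \<gamma> \<delta>) (\<tau>' (e' \<delta>)))
                 + (\<Sum>\<delta>=1..r - n. scale' (B2 \<gamma> \<delta>) (\<tau>' (\<tau>' (e' \<delta>))))"
  shows "is_dual_T_motive q \<theta> scale T \<tau> scale' T' \<tau>'"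
proof -
  interpret M: T_tau_module scale q T \<tau> by fact
  interpret N: T_tau_module scale' q T' \<tau>' by fact
  interpret T_tau_pair scale q T \<tau> scale' T' \<tau>' ..

  \<comment> \<open>Frobenius on the ground field and lower bounds for k(i)\<close>
  note e = e_basis[unfolded is_basis_free_family]
  \<comment> \<open>The basis vector with index 1, available because n is positive, reveals the
    additivity.\<close>
  have ap: "additive_power q TYPE('c)"
    by (rule M.additive_power_if_free[OF e, of 1]) (use n in \<open>auto simp: q zero_less_card_finite\<close>)
  have perfect: "\<exists>b. b ^ q = c" for c :: 'c
    by (rule is_C_infinity_perfect[OF C_inf ap])
  have k_mono: "k n \<le> k i" if "i \<in> {1..n}" for i
  proof -
    have "i \<le> n" "1 \<le> i" using that by auto
    then show ?thesis
    proof (induction i rule: inc_induct)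
      case (step i)
      then show ?case using k_decr[rule_format, of i] by simp
    qed simp
  qed
  then have k3: "k i \<ge> 3" if "i \<in> {1..n}" for i
    using that k_ge by (meson le_trans)

  \<comment> \<open>The \<open>T\<close>-basis of M\<close>
  let ?D = "motive_index n k"
  define f where "f = (\<lambda>(i, j). (\<tau> ^^ j) (e i))"
  have k_pos: "k i > 0" "k i > 1" if "i \<in> {1..n}" for i using k3[OF that] by simp_all
  have f_free: "free_family scale T ?D f"
    unfolding f_def by (rule motive_T_basis(1)[OF M ap k_pos(1) e T_e])
  have f_tau: "\<tau> (f s) = (\<Sum>t\<in>?D. poly_act scale T (motive_matrix k \<theta> a s t) (f t))" if "s \<in> ?D" for s
    unfolding f_def by (rule motive_T_basis(2)[OF M ap k_pos(1) e T_e that])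

  \<comment> \<open>Indexing the generators of M(B) by pairs\<close>
  define P where "P = {(i, j). i \<in> {1..n} \<and> j \<in> {1..k i - 2}}"
  define D1 where "D1 = {(i, j). (i, j) \<in> ?D \<and> j > 0}"
  \<comment> \<open>Extends \<nu> from \<open>P\<close> to \<open>D1\<close> by the top positions
    (i, k(i)-1), which receive the remaining numbers 1, ..., n.\<close>
  define \<sigma> where "\<sigma> = (\<lambda>(i, j). if Suc j = k i then i else \<nu> (i, j))"
  have nu_inj: "\<nu> s = \<nu> t \<longleftrightarrow> s = t" if "s \<in> P" "t \<in> P" for s t
    using nu that by (auto simp: bij_betw_def inj_on_eq_iff P_def)
  have nu_img: "\<nu> ` P = {n + 1..r - n}"
    using nu by (simp add: bij_betw_def P_def)
  \<comment> \<open>From 3n \<le> r one gets n \<le> r - n, so {1..n} and {n+1..r-n} together fill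
    {1..r-n}.\<close>
  have "(\<Sum>i=1..n. 3) \<le> r" unfolding r by (intro sum_mono k3)
  then have rn: "n \<le> r - n" by simp
  have D1_eq: "D1 = P \<union> {(i, k i - 1) | i. i \<in> {1..n}}"
    using k3 by (fastforce simp: D1_def P_def motive_index_def)
  have D1D: "(i, j) \<in> D1 \<longleftrightarrow> i \<in> {1..n} \<and> 0 < j \<and> j < k i" for i j
    by (auto simp: D1_def motive_index_def)
  have sig_P: "\<sigma> s = \<nu> s" "\<sigma> s > n" "\<sigma> s \<le> r - n" if "s \<in> P" for s
  proof -
    show *: "\<sigma> s = \<nu> s" using that by (auto simp: \<sigma>_def P_def)
    have "\<nu> s \<in> {n + 1..r - n}" using nu_img that by blast
    then show "\<sigma> s > n" "\<sigma> s \<le> r - n" by (auto simp: *)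
  qed
  have sig_top: "\<sigma> (i, k i - 1) = i" if "i \<in> {1..n}" for i
    using k3[OF that] by (simp add: \<sigma>_def)
  have sig_bij: "bij_betw \<sigma> D1 {1..r - n}"
    unfolding bij_betw_def
  proof
    show "inj_on \<sigma> D1"
    proof (rule inj_onI)
      fix s t assume st: "s \<in> D1" "t \<in> D1" "\<sigma> s = \<sigma> t"
      \<comment> \<open>The size of \<sigma> u tells the two kinds of positions apart, so
        injectivity can be checked on each kind.\<close>
      have low: "u \<in> P \<longleftrightarrow> n < \<sigma> u" if "u \<in> D1" for u
        using that sig_P(2)[of u] sig_top unfolding D1_eq by fastforce
      show "s = t"
      proof (cases "s \<in> P")
        case True
        then have "t \<in> P" using low st by simp
        with True show ?thesis using st(3) sig_P(1) nu_inj by simp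
      next
        case False
        then have "t \<notin> P" using low st by simp
        with False obtain i i' where "i \<in> {1..n}" "i' \<in> {1..n}" "s = (i, k i - 1)" "t = (i', k i' - 1)"
          using st(1,2) unfolding D1_eq by blast
        then show ?thesis using st(3) sig_top by simp
      qed
    qed
    have "\<sigma> ` D1 = \<sigma> ` P \<union> (\<lambda>i. \<sigma> (i, k i - 1)) ` {1..n}"
      unfolding D1_eq by auto
    also have "\<sigma> ` P = {n + 1..r - n}"
      using sig_P(1) nu_img by simp
    also have "(\<lambda>i. \<sigma> (i, k i - 1)) ` {1..n} = (\<lambda>i. i) ` {1..n}"
      by (intro image_cong refl sig_top)
    finally show "\<sigma> ` D1 = {1..r - n}" using rn by auto
  qed
  define E where "E = (\<lambda>s. e' (\<sigma> s))"
  have E: "free_family scale' \<tau>' D1 E"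
    unfolding E_def by (rule free_family_reindex[OF e'_basis[unfolded is_basis_free_family] sig_bij])

  \<comment> \<open>Entries of the matrices B1 and B2 in terms of pairs\<close>
  have B1_eq: "B1 (\<sigma> (i, j)) \<delta> = (if \<delta> \<in> {1..n} then - a j \<delta> i else 0)
      + (if 1 < j \<and> \<delta> = \<sigma> (i, j - 1) then 1 else 0)"
    if ij: "(i, j) \<in> D1" and \<delta>: "\<delta> \<in> {1..r - n}" for i j \<delta>
  proof -
    have i: "i \<in> {1..n}" and j: "0 < j" "j < k i" using ij D1D by auto
    have pred: "(i, j - 1) \<in> P" if "1 < j"
      using that i j by (auto simp: P_def)
    \<comment> \<open>Numbering by \<sigma> unifies the rules: those with entries -a become one rule
      for all j, and those with entry 1 both say that the column is the predecessor (i, j-1). The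
      two contributions never meet, since \<sigma> exceeds n at a predecessor.\<close>
    show ?thesis
    proof (cases "\<delta> \<in> {1..n}")
      case True
      then have "\<not> (1 < j \<and> \<delta> = \<sigma> (i, j - 1))"
        using sig_P(2)[OF pred] by auto
      moreover have "B1 (\<sigma> (i, j)) \<delta> = - a j \<delta> i"
      proof (cases "Suc j = k i")
        case T: True
        then have "j = k i - 1" by simp
        with T show ?thesis using B1_1 i True by (simp add: \<sigma>_def)
      next
        case False
        then have "j \<in> {1..k i - 2}" using j by auto
        then show ?thesis using B1_2 i True False by (simp add: \<sigma>_def)
      qed
      ultimately show ?thesis using True by simp
    next
      case False
      show ?thesis
      proof (cases "1 < j \<and> \<delta> = \<sigma> (i, j - 1)")
        case T: True
        then have \<delta>_eq: "\<delta> = \<nu> (i, j - 1)" using sig_P(1)[OF pred] by simp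
        have "B1 (\<sigma> (i, j)) \<delta> = 1"
        proof (cases "Suc j = k i")
          case True
          then have "j - 1 = k i - 2" by simp
          then show ?thesis using B1_4 i True \<delta>_eq by (simp add: \<sigma>_def)
        next
          case False
          have "j - 1 \<in> {1..k i - 3}" using T j False by auto
          with B1_3[rule_format, OF i this] show ?thesis using T False \<delta>_eq by (simp add: \<sigma>_def)
        qed
        then show ?thesis using False T by auto
      next
        case F: False
        have sig_range: "\<sigma> (i, j) \<in> {1..r - n}" using bij_betwE[OF sig_bij] ij by blast
        \<comment> \<open>As \<delta> > n, only the positions with entry 1 could match; by
          injectivity of \<sigma> a match would make \<delta> the predecessor of (i, j), which is
          excluded.\<close>
        have "(\<sigma> (i, j), \<delta>) \<noteq> (\<nu> (i', j' + 1), \<nu> (i', j'))" if "i' \<in> {1..n}" "j' \<in> {1..k i' - 3}" for i' j'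
        proof
          assume *: "(\<sigma> (i, j), \<delta>) = (\<nu> (i', j' + 1), \<nu> (i', j'))"
          have P': "(i', j' + 1) \<in> P" "(i', j') \<in> P" using that by (auto simp: P_def)
          have "(i', j' + 1) \<in> D1" using P' D1_eq by blast
          moreover have "\<sigma> (i, j) = \<sigma> (i', j' + 1)" using * sig_P(1)[OF P'(1)] by simp
          ultimately have "(i, j) = (i', j' + 1)"
            using sig_bij ij by (auto simp: bij_betw_def dest: inj_onD)
          then show False using F * sig_P(1)[OF P'(2)] that by auto
        qed
        moreover have "(\<sigma> (i, j), \<delta>) \<noteq> (i', \<nu> (i', k i' - 2))" if i': "i' \<in> {1..n}" for i'
        proof
          assume *: "(\<sigma> (i, j), \<delta>) = (i', \<nu> (i', k i' - 2))"
          have P': "(i', k i' - 2) \<in> P" using i' k3[OF i'] by (auto simp: P_def)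
          have "(i', k i' - 1) \<in> D1" using i' D1_eq by blast
          moreover have "\<sigma> (i, j) = \<sigma> (i', k i' - 1)" using * sig_top[OF i'] by simp
          ultimately have "(i, j) = (i', k i' - 1)"
            using sig_bij ij by (auto simp: bij_betw_def dest: inj_onD)
          moreover from this have "j - 1 = k i' - 2" "1 < j" using k3[OF i'] by auto
          ultimately show False using F * sig_P(1)[OF P'] by auto
        qed
        ultimately have "B1 (\<sigma> (i, j)) \<delta> = 0"
          using False by (intro B1_0[rule_format, OF sig_range \<delta>]) blast
        then show ?thesis using False F by auto
      qed
    qed
  qed
  have B2_eq: "B2 (\<sigma> (i, j)) \<delta> = (if j = 1 \<and> \<delta> = i then 1 else 0)"
    if ij: "(i, j) \<in> D1" and \<delta>: "\<delta> \<in> {1..r - n}" for i j \<delta>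
  proof -
    have one: "(i', 1) \<in> P" if "i' \<in> {1..n}" for i'
      using that k3[OF that] by (auto simp: P_def)
    have sig_range: "\<sigma> (i, j) \<in> {1..r - n}" using bij_betwE[OF sig_bij] ij by blast
    have i: "i \<in> {1..n}" using ij D1D by auto
    show ?thesis
    proof (cases "j = 1 \<and> \<delta> = i")
      case True
      then show ?thesis using B2_1 i sig_P(1)[OF one[OF i]] by simp
    next
      case False
      have "(\<sigma> (i, j), \<delta>) \<noteq> (\<nu> (i', 1), i')" if i': "i' \<in> {1..n}" for i'
      proof
        assume *: "(\<sigma> (i, j), \<delta>) = (\<nu> (i', 1), i')"
        have "(i', 1) \<in> D1" "\<sigma> (i, j) = \<sigma> (i', 1)"
          using one[OF i'] D1_eq * sig_P(1)[OF one[OF i']] by auto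
        then have "(i, j) = (i', 1)"
          using sig_bij ij by (auto simp: bij_betw_def dest: inj_onD)
        then show False using False * by simp
      qed
      then show ?thesis using False B2_0[rule_format, OF sig_range \<delta>] by auto
    qed
  qed

  \<comment> \<open>The \<open>T\<close>-basis of M(B)\<close>
  define f' where "f' = (\<lambda>(i, j). if j = 0 then \<tau>' (E (i, k i - 1)) else E (i, j))"
  have f'_0: "f' (i, 0) = \<tau>' (e' i)" if "i \<in> {1..n}" for i
    using sig_top[OF that] by (simp add: f'_def E_def)
  have T_E: "T' (E (i, Suc m)) = scale' \<theta> (E (i, Suc m))
      + \<tau>' (f' (i, m)) - (\<Sum>\<alpha>=1..n. scale' (a (Suc m) \<alpha> i) (f' (\<alpha>, 0)))"
    if i: "i \<in> {1..n}" and m: "Suc m < k i" for i m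
  proof -
    let ?S = "{1..r - n}"
    have ij: "(i, Suc m) \<in> D1" using i m D1D by simp
    have sig_range: "\<sigma> (i, Suc m) \<in> ?S" using bij_betwE[OF sig_bij] ij by blast
    have iS: "i \<in> ?S" using i rn by auto
    have "(\<Sum>\<delta>\<in>?S. scale' (B1 (\<sigma> (i, Suc m)) \<delta>) (\<tau>' (e' \<delta>)))
      = (\<Sum>\<delta>\<in>?S. (if \<delta> \<in> {1..n} then - scale' (a (Suc m) \<delta> i) (\<tau>' (e' \<delta>)) else 0)
          + (if \<delta> = \<sigma> (i, m) then if 0 < m then \<tau>' (e' \<delta>) else 0 else 0))"
      by (intro sum.cong refl, subst B1_eq[OF ij]) (auto simp: N.scale_left_distrib)
    also have "\<dots> = - (\<Sum>\<alpha>=1..n. scale' (a (Suc m) \<alpha> i) (\<tau>' (e' \<alpha>)))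
        + (if 0 < m then \<tau>' (e' (\<sigma> (i, m))) else 0)"
    proof -
      have "\<sigma> (i, m) \<in> ?S" if "0 < m"
        using bij_betwE[OF sig_bij] D1D[of i m] i m that by auto
      moreover have "(\<Sum>\<delta>\<in>?S. if \<delta> \<in> {1..n} then - scale' (a (Suc m) \<delta> i) (\<tau>' (e' \<delta>)) else 0)
          = (\<Sum>\<delta>=1..n. - scale' (a (Suc m) \<delta> i) (\<tau>' (e' \<delta>)))"
        by (rule sum.mono_neutral_cong_right) (use rn in auto)
      ultimately show ?thesis
        unfolding sum.distrib by (auto simp: sum_negf)
    qed
    finally have 1: "(\<Sum>\<delta>\<in>?S. scale' (B1 (\<sigma> (i, Suc m)) \<delta>) (\<tau>' (e' \<delta>)))
      = - (\<Sum>\<alpha>=1..n. scale' (a (Suc m) \<alpha> i) (\<tau>' (e' \<alpha>)))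
        + (if 0 < m then \<tau>' (e' (\<sigma> (i, m))) else 0)" .
    have "(\<Sum>\<delta>\<in>?S. scale' (B2 (\<sigma> (i, Suc m)) \<delta>) (\<tau>' (\<tau>' (e' \<delta>))))
      = (\<Sum>\<delta>\<in>?S. if \<delta> = i then if m = 0 then \<tau>' (\<tau>' (e' i)) else 0 else 0)"
      by (intro sum.cong refl, subst B2_eq[OF ij]) auto
    also have "\<dots> = (if m = 0 then \<tau>' (\<tau>' (e' i)) else 0)"
      using iS by simp
    finally have 2: "(\<Sum>\<delta>\<in>?S. scale' (B2 (\<sigma> (i, Suc m)) \<delta>) (\<tau>' (\<tau>' (e' \<delta>))))
      = (if m = 0 then \<tau>' (\<tau>' (e' i)) else 0)" .
    \<comment> \<open>For m = 0 this term is supplied by B2, for m > 0 by the entry 1 of B1; the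
      definition of \<open>f'\<close> at position 0 merges both cases.\<close>
    have 3: "\<tau>' (f' (i, m)) = (if m = 0 then \<tau>' (\<tau>' (e' i)) else \<tau>' (e' (\<sigma> (i, m))))"
      using f'_0[OF i] by (auto simp: f'_def E_def)
    have 4: "(\<Sum>\<alpha>=1..n. scale' (a (Suc m) \<alpha> i) (f' (\<alpha>, 0)))
        = (\<Sum>\<alpha>=1..n. scale' (a (Suc m) \<alpha> i) (\<tau>' (e' \<alpha>)))"
      by (intro sum.cong refl) (simp add: f'_0)
    show ?thesis
      using T_e'[rule_format, OF sig_range] unfolding 1 2 3 4 E_def by (cases "m = 0") simp_all
  qed
  note f'_basis = dual_T_basis[OF MB ap k_pos(2) E[unfolded D1_def] T_E[unfolded f'_def], folded f'_def]
  have f'_free: "free_family scale' T' ?D f'"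
    by (rule f'_basis(1))
  have f'_tau: "\<tau>' (f' s) = (\<Sum>t\<in>?D. poly_act scale' T' (dual_matrix k \<theta> a s t) (f' t))" if "s \<in> ?D" for s
    by (rule f'_basis(2)[OF _ _ _ that])

  \<comment> \<open>Both modules are abelian T-motives\<close>
  have M_abelian: "abelian_T_motive q \<theta> scale T \<tau>"
  proof (rule abelian_T_motiveI[OF M perfect f_free e])
    fix i assume i: "i \<in> {1..n}"
    note sub = M.subspace_range_tau[OF perfect]
    have pow: "(\<tau> ^^ j) x \<in> range \<tau>" if "j > 0" for j x
      using that by (cases j) auto
    \<comment> \<open>Every power of \<tau> that occurs is positive, and the scalars are absorbed
      because the Frobenius is onto.\<close>
    have "(\<Sum>\<alpha>=1..n. \<Sum>j=1..k \<alpha> - 1. scale (a j i \<alpha>) ((\<tau> ^^ j) (e \<alpha>))) + (\<tau> ^^ k i) (e i) \<in> range \<tau>"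
      using k3[OF i] by (intro M.subspace_add[OF sub] M.subspace_sum[OF sub] M.subspace_scale[OF sub] pow) auto
    then show "T (e i) - scale \<theta> (e i) \<in> range \<tau>"
      using T_e i by (simp add: algebra_simps)
  qed
  have N_abelian: "abelian_T_motive q \<theta> scale' T' \<tau>'"
  proof (rule abelian_T_motiveI[OF MB perfect f'_free e'_basis[unfolded is_basis_free_family]])
    fix \<gamma> assume \<gamma>: "\<gamma> \<in> {1..r - n}"
    note sub = N.subspace_range_tau[OF perfect]
    have "(\<Sum>\<delta>=1..r - n. scale' (B1 \<gamma> \<delta>) (\<tau>' (e' \<delta>)))
        + (\<Sum>\<delta>=1..r - n. scale' (B2 \<gamma> \<delta>) (\<tau>' (\<tau>' (e' \<delta>)))) \<in> range \<tau>'"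
      by (intro N.subspace_add[OF sub] N.subspace_sum[OF sub] N.subspace_scale[OF sub] rangeI)
    then show "T' (e' \<gamma>) - scale' \<theta> (e' \<gamma>) \<in> range \<tau>'"
      using T_e' \<gamma> by (simp add: algebra_simps)
  qed

  \<comment> \<open>Numbering the pairs and comparing the two matrices of \<tau>\<close>
  obtain \<pi> where \<pi>: "bij_betw \<pi> {..<card ?D} ?D"
    using ex_bij_betw_nat_finite[OF finite_motive_index] by (auto simp: atLeast0LessThan)
  let ?m = "card ?D"
  let ?Q = "mat ?m ?m (\<lambda>(x, y). motive_matrix k \<theta> a (\<pi> x) (\<pi> y))"
  let ?R = "mat ?m ?m (\<lambda>(x, y). dual_matrix k \<theta> a (\<pi> x) (\<pi> y))"
  have RQ: "?R * transpose_mat ?Q = [:- \<theta>, 1:] \<cdot>\<^sub>m 1\<^sub>m ?m"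
  proof (rule eq_matI)
    fix x y assume "x < dim_row ([:- \<theta>, 1:] \<cdot>\<^sub>m 1\<^sub>m ?m)" "y < dim_col ([:- \<theta>, 1:] \<cdot>\<^sub>m 1\<^sub>m ?m)"
    then have xy: "x < ?m" "y < ?m" by auto
    have "(?R * transpose_mat ?Q) $$ (x, y)
        = (\<Sum>z<?m. dual_matrix k \<theta> a (\<pi> x) (\<pi> z) * motive_matrix k \<theta> a (\<pi> y) (\<pi> z))"
      using xy by (auto simp: scalar_prod_def atLeast0LessThan intro!: sum.cong)
    also have "\<dots> = (\<Sum>t\<in>?D. dual_matrix k \<theta> a (\<pi> x) t * motive_matrix k \<theta> a (\<pi> y) t)"
      by (rule sum.reindex_bij_betw[OF \<pi>])
    also have "\<dots> = (if \<pi> x = \<pi> y then [:- \<theta>, 1:] else 0)"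
      by (rule dual_matrix_mult_motive_matrix) (use \<pi> xy in \<open>auto dest: bij_betwE\<close>)
    also have "\<pi> x = \<pi> y \<longleftrightarrow> x = y"
      using \<pi> xy by (auto simp: bij_betw_def dest: inj_onD)
    finally show "(?R * transpose_mat ?Q) $$ (x, y) = ([:- \<theta>, 1:] \<cdot>\<^sub>m 1\<^sub>m ?m) $$ (x, y)"
      using xy by simp
  qed auto
  have Q: "tau_matrix scale T \<tau> ?m (\<lambda>x. f (\<pi> x)) ?Q"
    by (rule tau_matrix_reindex[OF \<pi>]) (rule f_tau)
  have R: "tau_matrix scale' T' \<tau>' ?m (\<lambda>x. f' (\<pi> x)) ?R"
    by (rule tau_matrix_reindex[OF \<pi>]) (rule f'_tau)
  show ?thesis
    by (rule is_dual_if_canonical_bases[OF ap M_abelian N_abelian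
        free_family_reindex[OF f_free \<pi>] Q free_family_reindex[OF f'_free \<pi>] R RQ])
qed

end
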